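(* Let $I\ge 2$ be an integer, let $B$ be a set with $\{1\}\subseteq B\subseteq\{1,\ldots,\lfloor I/2\rfloor\}$, let $z_0\in\mathrm{dom}\,h$, let $D\ge d_0$ be an over-estimate of $d_0$, and let $$\lambda=\frac{D\sqrt{I+1}}{2M\sqrt{22\log(I+1)}}.$$ Then the output $(z_I,z_I^a,u_I)$ of the method S-Max1C with input $(\lambda,I,B,z_0)$ satisfies $$\mathbb{E}[\phi(z_I^a)]-\phi_*\le \mathbb{E}[u_I]-\phi_*\le \frac{2\sqrt{\log(I+1)}}{\sqrt{I+1}}\left[\sqrt{22}\,MD+2\sigma(x_* )\sqrt{|B|-1}\right].$$
   Context: Problem: $\phi_*:=\min\{\phi(x):=f(x)+h(x):x\in\mathbb{R}^n\}$ with $f(x)=\mathbb{E}_\xi[F(x,\xi)]$, where $\xi$ is a random vector with support $\Xi$. $\log$ is the natural logarithm, $\|\cdot\|$ the Euclidean norm, and $\mathrm{dom}\,\psi=\{x:\psi(x)<\infty\}$. Standing assumptions. (i) $f,h:\mathbb{R}^n\to\mathbb{R}\cup\{+\infty\}$ are proper closed convex functions with $\mathrm{dom}\,h\subseteq\mathrm{dom}\,f$. (ii) For almost every $\xi\in\Xi$ a convex function $F(\cdot,\xi):\mathrm{dom}\,h\to\mathbb{R}$ and a map $s(\cdot,\xi):\mathrm{dom}\,h\to\mathbb{R}^n$ are available such that for every $x\in\mathrm{dom}\,h$, $f(x)=\mathbb{E}[F(x,\xi)]$ and $s(x,\xi)\in\partial F(x,\xi)$, i.e. $F(u,\xi)\ge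 F(x,\xi)+\langle s(x,\xi),u-x\rangle$ for all $u\in\mathrm{dom}\,h$. (iii) $M:=\sup\{\mathbb{E}[\|s(x,\xi)\|^2]^{1/2}:x\in\mathrm{dom}\,h\}<\infty$. (iv) The set $X_*$ of minimizers of $\phi$ is nonempty. Notation. $\Phi(\cdot;\xi)=F(\cdot,\xi)+h(\cdot)$; $\ell(\cdot,x;\xi)=F(x,\xi)+h(\cdot)+\langle s(x,\xi),\cdot-x\rangle$; $\sigma(u)=\sqrt{\mathbb{E}[(\Phi(u;\xi)-\phi(u))^2]}$; $x_*:=\mathrm{argmin}\{\|z_0-x\|:x\in X_*\}$ and $d_0:=\|z_0-x_*\|$. The quantities are such that $\lambda$ is a well-defined positive number (i.e. $M>0$, $D>0$). All random quantities are measurable, the expectations are understood to be well defined, and $0\cdot\infty=0$. Method S-Max1C. Input: $\lambda>0$, integer $I\ge 2$, set $B$ with $\{1\}\subseteq B\subseteq\{1,\ldots,\lfloor I/2\rfloor\}$, $z_0\in\mathrm{dom}\,h$. Let $\beta=\frac{I+1-\log(I+1)}{I+1+\log(I+1)}$ and let $\xi_0,\xi_1,\ldots,\xi_I$ be independent samples of $\xi$. For $j=1,\ldots,I$: (1) $\Gamma_1(\cdot)=\ell(\cdot,z_0;\xi_0)$; for $j\ge2$ with $j\in B$, $\Gamma_j(\cdot)=(1-\beta)\ell(\cdot,z_{j-1};\xi_{j-1})+\beta\max\{\Gamma_{j-1}(\cdot),\ell(\cdot,z_{j-1};\xi_{j-1})\}$; for $j\ge 2$ with $j\notin B$, $\Gamma_j(\cdot)=(1-\beta)\ell(\cdot,z_{j-1};\xi_{j-1})+\beta\Gamma_{j-1}(\cdot)$;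 (2) $z_j=\mathrm{argmin}_{u\in\mathbb{R}^n}\{\Gamma_j(u)+\frac{1}{2\lambda}\|u-z_0\|^2\}$; (3) $z_1^a=z_1$ and $z_j^a=(1-\beta)z_j+\beta z_{j-1}^a$ for $j\ge2$; (4) $u_1=\Phi(z_1;\xi_1)$ and $u_j=(1-\beta)\Phi(z_j;\xi_j)+\beta u_{j-1}$ for $j\ge2$. Output: $(z_I,z_I^a,u_I)$. *)

theory Defs
  imports "HOL-Probability.Probability"
begin

section \<open>Extended-real-valued functions and expectations\<close>

definition edom :: "('a \<Rightarrow> ereal) \<Rightarrow> 'a set" where
  "edom \<psi> = {x. \<psi> x < \<infinity>}"

definition epi :: "('a \<Rightarrow> ereal) \<Rightarrow> ('a \<times> real) set" where
  "epi \<psi> = {(x, r). \<psi> x \<le> ereal r}"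

definition proper_closed_convex :: "('a::euclidean_space \<Rightarrow> ereal) \<Rightarrow> bool" where
  "proper_closed_convex \<psi> \<longleftrightarrow>
     (\<forall>x. \<psi> x \<noteq> -\<infinity>) \<and> edom \<psi> \<noteq> {} \<and> closed (epi \<psi>) \<and> convex (epi \<psi>)"

definition subdifferential :: "'a::real_inner set \<Rightarrow> ('a \<Rightarrow> real) \<Rightarrow> 'a \<Rightarrow> 'a set" where
  "subdifferential S g x = {v. \<forall>u\<in>S. g u \<ge> g x + v \<bullet> (u - x)}"

text \<open>
  \<open>E[X\<^sup>+] - E[X\<^sup>-]\<close>. Unlike the Bochner integral it is not silently \<open>0\<close> for a
  non-integrable variable. Since \<open>\<infinity> - \<infinity> = \<infinity>\<close> in \<^typ>\<open>ereal\<close>, a finite upper bound on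
  it entails \<open>E[X\<^sup>+] < \<infinity>\<close>.
\<close>

definition eexpectation :: "'a measure \<Rightarrow> ('a \<Rightarrow> ereal) \<Rightarrow> ereal" where
  "eexpectation M X =
     enn2ereal (\<integral>\<^sup>+\<omega>. e2ennreal (X \<omega>) \<partial>M) - enn2ereal (\<integral>\<^sup>+\<omega>. e2ennreal (- X \<omega>) \<partial>M)"

definition esqrt :: "ereal \<Rightarrow> ereal" where
  "esqrt r = (if r = \<infinity> then \<infinity> else ereal (sqrt (real_of_ereal r)))"


section \<open>The stochastic composite problem\<close>

text \<open>
  \<open>F x \<xi>\<close> and \<open>s x \<xi>\<close> are total functions here; only their values at \<open>x \<in> edom h\<close> matter.
\<close>

definition phi :: "('a \<Rightarrow> ereal) \<Rightarrow> ('a \<Rightarrow> ereal) \<Rightarrow> 'a \<Rightarrow> ereal" where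
  "phi f h x = f x + h x"

definition minimizers :: "('a \<Rightarrow> ereal) \<Rightarrow> 'a set" where
  "minimizers \<psi> = {x. \<forall>y. \<psi> x \<le> \<psi> y}"

definition Phi :: "('a \<Rightarrow> 'b \<Rightarrow> real) \<Rightarrow> ('a \<Rightarrow> ereal) \<Rightarrow> 'a \<Rightarrow> 'b \<Rightarrow> ereal" where
  "Phi F h u \<xi> = ereal (F u \<xi>) + h u"

definition ell :: "('a::real_inner \<Rightarrow> 'b \<Rightarrow> real) \<Rightarrow> ('a \<Rightarrow> 'b \<Rightarrow> 'a) \<Rightarrow> ('a \<Rightarrow> ereal)
    \<Rightarrow> 'a \<Rightarrow> 'b \<Rightarrow> 'a \<Rightarrow> ereal" where
  "ell F s h x \<xi> u = ereal (F x \<xi>) + h u + ereal (s x \<xi> \<bullet> (u - x))"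

definition noise_std :: "'b measure \<Rightarrow> ('a \<Rightarrow> 'b \<Rightarrow> real) \<Rightarrow> ('a \<Rightarrow> ereal) \<Rightarrow> ('a \<Rightarrow> ereal)
    \<Rightarrow> 'a \<Rightarrow> ereal" where
  "noise_std P F f h u = esqrt (eexpectation P (\<lambda>\<xi>. (Phi F h u \<xi> - phi f h u)\<^sup>2))"

definition subgrad_bound :: "'b measure \<Rightarrow> ('a::real_normed_vector \<Rightarrow> 'b \<Rightarrow> 'a) \<Rightarrow> ('a \<Rightarrow> ereal)
    \<Rightarrow> ereal" where
  "subgrad_bound P s h =
     (SUP x\<in>edom h. esqrt (eexpectation P (\<lambda>\<xi>. ereal ((norm (s x \<xi>))\<^sup>2))))"


section \<open>The method S-Max1C\<close>

definition smax_beta :: "nat \<Rightarrow> real" where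
  "smax_beta I = (real I + 1 - ln (real I + 1)) / (real I + 1 + ln (real I + 1))"

text \<open>
  The method for one realization \<open>w 0, \<dots>, w I\<close> of the samples. \<open>smax_z \<dots> w 0\<close> is the
  initial point; \<open>\<Gamma>\<close>, \<open>z\<^sup>a\<close> and \<open>u\<close> start at index 1 and are left unspecified at 0.
\<close>

context
  fixes F :: "'a::euclidean_space \<Rightarrow> 'b \<Rightarrow> real"
    and s :: "'a \<Rightarrow> 'b \<Rightarrow> 'a"
    and h :: "'a \<Rightarrow> ereal"
    and lam :: real
    and I :: nat
    and B :: "nat set"
    and z0 :: 'a
begin

function smax_Gamma :: "(nat \<Rightarrow> 'b) \<Rightarrow> nat \<Rightarrow> 'a \<Rightarrow> ereal"
  and smax_z :: "(nat \<Rightarrow> 'b) \<Rightarrow> nat \<Rightarrow> 'a" where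
  "smax_Gamma w 0 = undefined"
| "smax_Gamma w (Suc 0) = ell F s h z0 (w 0)"
| "smax_Gamma w (Suc (Suc i)) =
     (let \<beta> = smax_beta I;
          l = ell F s h (smax_z w (Suc i)) (w (Suc i));
          G = smax_Gamma w (Suc i)
      in if Suc (Suc i) \<in> B
         then (\<lambda>u. ereal (1 - \<beta>) * l u + ereal \<beta> * max (G u) (l u))
         else (\<lambda>u. ereal (1 - \<beta>) * l u + ereal \<beta> * G u))"
| "smax_z w 0 = z0"
| "smax_z w (Suc i) =
     (ARG_MIN (\<lambda>u. smax_Gamma w (Suc i) u + ereal (1 / (2 * lam) * (norm (u - z0))\<^sup>2)) u. True)"
  by pat_completeness auto
termination
  by (relation "Wellfounded.measure (case_sum (\<lambda>(w, j). 2 * j) (\<lambda>(w, j). 2 * j + 1))") auto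

fun smax_za :: "(nat \<Rightarrow> 'b) \<Rightarrow> nat \<Rightarrow> 'a" where
  "smax_za w 0 = undefined"
| "smax_za w (Suc 0) = smax_z w 1"
| "smax_za w (Suc (Suc i)) =
     (1 - smax_beta I) *\<^sub>R smax_z w (Suc (Suc i)) + smax_beta I *\<^sub>R smax_za w (Suc i)"

fun smax_u :: "(nat \<Rightarrow> 'b) \<Rightarrow> nat \<Rightarrow> ereal" where
  "smax_u w 0 = undefined"
| "smax_u w (Suc 0) = Phi F h (smax_z w 1) (w 1)"
| "smax_u w (Suc (Suc i)) =
     ereal (1 - smax_beta I) * Phi F h (smax_z w (Suc (Suc i))) (w (Suc (Suc i)))
     + ereal (smax_beta I) * smax_u w (Suc i)"

end

end

theory Submission
  imports Defs
begin

text \<open>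
  Let \<open>m\<^sub>j\<close> be the optimal value of the regularized model
  \<open>\<Gamma>\<^sub>j + \<parallel>\<cdot> - z\<^sub>0\<parallel>\<^sup>2 / (2\<lambda>)\<close>, attained at \<open>z\<^sub>j\<close>. The proof sandwiches \<open>E[m\<^sub>I]\<close>.

  From above, \<open>m\<^sub>I \<le> \<Gamma>\<^sub>I(x\<^sub>*) + D\<^sup>2 / (2\<lambda>)\<close>. Each linearization lies below the sampled cost, so
  \<open>\<Gamma>\<^sub>I(x\<^sub>*) - \<phi>\<^sub>*\<close> is at most the same damped aggregate of the centred noises
  \<open>\<Phi>(x\<^sub>*; \<xi>\<^sub>i) - \<phi>\<^sub>*\<close>. Maxima bias the mean of this aggregate upwards. However, a second-moment
  count (\<open>damped_max_second_moment\<close>) charges one variance per index of \<open>B\<close>, and as \<open>B\<close> lies in the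
  first half of the iterations, the second half damps the bias \<open>\<sigma> \<surd>|B|\<close> by a further factor
  \<open>1 / \<surd>(I + 1)\<close> (\<open>noise_bound\<close>, \<open>smax_beta_half_power\<close>). For \<open>B = {1}\<close> there is no bias at all,
  and for \<open>|B| \<ge> 2\<close> one has \<open>|B| \<le> 2 (|B| - 1)\<close>.

  From below, \<open>u\<^sub>j - m\<^sub>j\<close> satisfies a damped recursion (\<open>gap_le_error\<close>). The model dominates
  \<open>(1 - \<beta>)\<close> times the newest linearization plus \<open>\<beta>\<close> times the old model; strong convexity of the
  old regularized model contributes \<open>\<beta> \<parallel>z\<^sub>j - z\<^sub>j\<^sub>-\<^sub>1\<parallel>\<^sup>2 / (2\<lambda>)\<close>, and Young's inequality uses it to
  absorb the error of linearizing at \<open>z\<^sub>j\<^sub>-\<^sub>1\<close>. What is left consists of squared subgradients, whose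
  means are at most \<open>M\<^sup>2\<close>, and of differences \<open>F(z\<^sub>j\<^sub>-\<^sub>1, \<xi>\<^sub>j) - F(z\<^sub>j\<^sub>-\<^sub>1, \<xi>\<^sub>j\<^sub>-\<^sub>1)\<close>, whose means
  vanish because \<open>z\<^sub>j\<^sub>-\<^sub>1\<close> is independent of both samples (\<open>Z_xi_law\<close>). Summing up,
  \<open>E[u\<^sub>I - m\<^sub>I] \<le> 2\<lambda>M\<^sup>2 (\<beta>\<^sup>I\<^sup>-\<^sup>1 + (1 - \<beta>) / \<beta>) \<le> 2\<lambda>M\<^sup>2 \<cdot> 22 ln (I + 1) / (I + 1)\<close>, and the choice
  of \<open>\<lambda>\<close> makes this equal to \<open>D\<^sup>2 / (2\<lambda>)\<close>.

  The inequality between \<open>E[\<phi>(z\<^sub>I\<^sup>a)]\<close> and \<open>E[u\<^sub>I]\<close> is convexity together with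
  \<open>E[F(z\<^sub>j, \<xi>\<^sub>j)] = E[f(z\<^sub>j)]\<close>. All this presupposes that the iterates are measurable
  (\<open>prox_measurable\<close>) and that the expectations are finite (\<open>Z_square_integrable\<close>, \<open>F_integrable\<close>).
\<close>

section \<open>Proximal steps of closed convex functions\<close>

lemma proper_closed_convex_not_MInf: "proper_closed_convex h \<Longrightarrow> h x \<noteq> -\<infinity>"
  by (simp add: proper_closed_convex_def)

lemma ereal_real_on_edom:
  assumes "proper_closed_convex h" "x \<in> edom h"
  shows "ereal (real_of_ereal (h x)) = h x"
  using assms by (cases "h x") (auto simp: proper_closed_convex_def edom_def)

lemma edom_convex_combination:
  assumes h: "proper_closed_convex h" and x: "x \<in> edom h" and y: "y \<in> edom h"
    and t: "0 \<le> t" "t \<le> 1"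
  shows "(1 - t) *\<^sub>R x + t *\<^sub>R y \<in> edom h"
    and "real_of_ereal (h ((1 - t) *\<^sub>R x + t *\<^sub>R y))
      \<le> (1 - t) * real_of_ereal (h x) + t * real_of_ereal (h y)"
proof -
  let ?r = "\<lambda>x. real_of_ereal (h x)" and ?p = "(1 - t) *\<^sub>R x + t *\<^sub>R y"
  have "(x, ?r x) \<in> epi h" "(y, ?r y) \<in> epi h"
    using ereal_real_on_edom[OF h x] ereal_real_on_edom[OF h y] by (auto simp: epi_def)
  moreover have "convex (epi h)" using h by (simp add: proper_closed_convex_def)
  ultimately have "(1 - t) *\<^sub>R (x, ?r x) + t *\<^sub>R (y, ?r y) \<in> epi h"
    using t by (intro convexD) auto
  then have le: "h ?p \<le> ereal ((1 - t) * ?r x + t * ?r y)"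
    by (simp add: epi_def)
  then show p: "?p \<in> edom h" by (auto simp: edom_def intro: le_less_trans)
  show "?r ?p \<le> (1 - t) * ?r x + t * ?r y"
    using le ereal_real_on_edom[OF h p] by (metis ereal_less_eq(3))
qed

lemma closed_sublevel:
  assumes "proper_closed_convex h"
  shows "closed {x. h x \<le> ereal r}"
proof -
  have "closed ((\<lambda>x. (x, r)) -` epi h)"
    using assms by (intro closed_vimage continuous_intros) (auto simp: proper_closed_convex_def)
  also have "(\<lambda>x. (x, r)) -` epi h = {x. h x \<le> ereal r}" by (auto simp: epi_def)
  finally show ?thesis .
qed

lemma proper_closed_convex_measurable:
  assumes "proper_closed_convex h"
  shows "h \<in> borel_measurable borel"
proof (rule borel_measurableI_le)
  fix y
  show "{x \<in> space borel. h x \<le> y} \<in> sets borel"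
  proof (cases y)
    case (real r) then show ?thesis using closed_sublevel[OF assms] by simp
  next
    case MInf then show ?thesis using proper_closed_convex_not_MInf[OF assms] by simp
  qed simp
qed

text \<open>
  Neither summand is \<open>-\<infinity>\<close>, so \<open>c < f x + h x\<close> holds exactly when \<open>c\<close> splits as
  \<open>c \<le> a + b\<close> with \<open>a < f x\<close> and \<open>b < h x\<close>; the complement of the sublevel set is
  therefore a union of open sets.
\<close>

lemma closed_sublevel_sum:
  assumes f: "proper_closed_convex f" and h: "proper_closed_convex h"
  shows "closed {x. f x + h x \<le> ereal c}"
proof -
  have op: "open {x. ereal a < g x}" if "proper_closed_convex g" for g and a
    using closed_sublevel[OF that, of a] by (simp add: closed_def Compl_eq not_le)
  have "{x. ereal c < f x + h x}
      = (\<Union>(a, b)\<in>{(a, b). c \<le> a + b}. {x. ereal a < f x} \<inter> {x. ereal b < h x})"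
    (is "?L = ?R")
  proof (intro equalityI subsetI)
    fix x assume "x \<in> ?L"
    then have less: "ereal c < f x + h x" by simp
    have "f x \<noteq> -\<infinity>" "h x \<noteq> -\<infinity>" using f h proper_closed_convex_not_MInf by auto
    then have "\<exists>a b. c \<le> a + b \<and> ereal a < f x \<and> ereal b < h x"
    proof (cases "f x")
      case PInf
      have "-\<infinity> < h x" using \<open>h x \<noteq> -\<infinity>\<close> by simp
      then obtain b where "ereal b < h x" using ereal_dense2 by blast
      then show ?thesis using PInf by (intro exI[of _ "c - b"] exI[of _ b]) simp
    next
      case (real p)
      show ?thesis
      proof (cases "h x")
        case PInf
        then show ?thesis using real by (intro exI[of _ "p - 1"] exI[of _ "c - p + 1"]) simp
      next
        case (real q)
        with less \<open>f x = ereal p\<close> have pq: "c < p + q" by simp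
        define e where "e = (p + q - c) / 2"
        have "c \<le> (p - e) + (q - e)" "p - e < p" "q - e < q" using pq by (auto simp: e_def field_simps)
        then show ?thesis using real \<open>f x = ereal p\<close>
          by (intro exI[of _ "p - e"] exI[of _ "q - e"]) simp
      qed (use \<open>h x \<noteq> -\<infinity>\<close> in simp)
    qed (use \<open>f x \<noteq> -\<infinity>\<close> in simp)
    then show "x \<in> ?R" by blast
  next
    fix x assume "x \<in> ?R"
    then obtain a b where ab: "c \<le> a + b" "ereal a < f x" "ereal b < h x" by auto
    have "ereal c \<le> ereal a + ereal b" using ab by simp
    also have "\<dots> < f x + h x" using ab by (intro ereal_add_strict_mono2)
    finally show "x \<in> ?L" by simp
  qed
  moreover have "open ?R" by (intro open_UN ballI) (auto intro!: open_Int op f h)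
  ultimately have "open {x. ereal c < f x + h x}" by simp
  then show ?thesis by (simp add: closed_def Compl_eq not_le)
qed

lemma closest_minimizer_in_minimizers:
  assumes f: "proper_closed_convex f" and h: "proper_closed_convex h" and dom: "edom h \<subseteq> edom f"
    and ne: "minimizers (phi f h) \<noteq> {}"
  shows "closest_point (minimizers (phi f h)) z \<in> minimizers (phi f h)"
proof -
  obtain x0 where x0: "x0 \<in> minimizers (phi f h)" using ne by auto
  obtain y where y: "y \<in> edom h" using h by (auto simp: proper_closed_convex_def)
  have "phi f h x0 \<le> phi f h y" using x0 by (simp add: minimizers_def)
  also have "\<dots> < \<infinity>" using y dom by (auto simp: phi_def edom_def)
  finally obtain c where c: "phi f h x0 = ereal c"
    using proper_closed_convex_not_MInf[OF f] proper_closed_convex_not_MInf[OF h]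
    by (cases "phi f h x0") (auto simp: phi_def ereal_plus_eq_MInfty)
  have "minimizers (phi f h) = {x. f x + h x \<le> ereal c}"
  proof (intro equalityI subsetI)
    fix x assume "x \<in> {x. f x + h x \<le> ereal c}"
    then have "phi f h x \<le> phi f h x0" using c by (simp add: phi_def)
    moreover have "phi f h x0 \<le> phi f h y" for y using x0 by (simp add: minimizers_def)
    ultimately show "x \<in> minimizers (phi f h)" unfolding minimizers_def by (blast intro: order_trans)
  next
    fix x assume "x \<in> minimizers (phi f h)"
    then have "phi f h x \<le> phi f h x0" unfolding minimizers_def by blast
    then show "x \<in> {x. f x + h x \<le> ereal c}" using c by (simp add: phi_def)
  qed
  then have "closed (minimizers (phi f h))" using closed_sublevel_sum[OF f h] by simp
  then show ?thesis using ne by (intro closest_point_in_set)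
qed

text \<open>
  The point of height \<open>h z0 - 1\<close> above \<open>z0\<close> lies strictly below the epigraph, and a hyperplane
  that separates the two is the graph of an affine minorant. Its slope is kept only in norm,
  which is enough both for coercivity and for the integrability of \<open>h\<close> along the iterates.
\<close>

lemma affine_minorant:
  fixes h :: "'a::euclidean_space \<Rightarrow> ereal"
  assumes h: "proper_closed_convex h" and z0: "z0 \<in> edom h"
  obtains A where "A \<ge> 0"
    and "\<And>u. u \<in> edom h \<Longrightarrow> real_of_ereal (h u) \<ge> real_of_ereal (h z0) - 1 - A * norm (u - z0)"
proof -
  let ?r = "\<lambda>x. real_of_ereal (h x)"
  have epi: "(u, ?r u) \<in> epi h" if "u \<in> edom h" for u
    using ereal_real_on_edom[OF h that] by (simp add: epi_def)
  obtain r0 where "h z0 = ereal r0" by (rule that[OF ereal_real_on_edom[OF h z0, symmetric]])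
  then have "\<not> h z0 \<le> ereal (?r z0 - 1)" by simp
  then have notin: "(z0, ?r z0 - 1) \<notin> epi h" by (simp add: epi_def)
  have "convex (epi h)" "closed (epi h)" using h by (auto simp: proper_closed_convex_def)
  then obtain p b where "p \<bullet> (z0, ?r z0 - 1) < b" "\<And>x. x \<in> epi h \<Longrightarrow> p \<bullet> x > b"
    using separating_hyperplane_closed_point[OF _ _ notin] by blast
  moreover obtain a c where "p = (a, c)" by (cases p)
  ultimately have *: "a \<bullet> z0 + c * (?r z0 - 1) < a \<bullet> u + c * ?r u" if "u \<in> edom h" for u
    using epi[OF that] by (force simp: inner_prod_def)
  from *[OF z0] have c: "c > 0" by (simp add: algebra_simps)
  show ?thesis
  proof
    show "norm a / c \<ge> 0" using c by simp
    fix u assume u: "u \<in> edom h"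
    have "a \<bullet> (z0 - u) + c * (?r z0 - 1) < c * ?r u" using *[OF u] by (simp add: inner_diff_right)
    moreover have "- (norm a * norm (u - z0)) \<le> a \<bullet> (z0 - u)"
      using Cauchy_Schwarz_ineq2[of a "z0 - u"] by (simp add: norm_minus_commute)
    ultimately have "c * (?r z0 - 1) - norm a * norm (u - z0) \<le> c * ?r u" by linarith
    then show "?r u \<ge> ?r z0 - 1 - norm a / c * norm (u - z0)"
      using c by (simp add: field_simps)
  qed
qed

lemma square_le_of_quadratic:
  fixes d a b :: real
  assumes "d\<^sup>2 \<le> a * d + b"
  shows "d\<^sup>2 \<le> a\<^sup>2 + 2 * b"
proof -
  have "0 \<le> (d - a)\<^sup>2" by simp
  then show ?thesis using assms by (simp add: power2_diff algebra_simps)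
qed

text \<open>
  The minimization is carried out over the epigraph of \<open>h\<close> rather than over its domain: the
  function \<open>(u, r) \<mapsto> \<psi> u + r + \<parallel>u - z0\<parallel>\<^sup>2 / (2 lam)\<close> is continuous, and the quadratic
  term beats the linear lower bounds of \<open>\<psi>\<close> and \<open>h\<close>, so its sublevel sets in the closed set
  \<open>epi h\<close> are compact.
\<close>

lemma prox_exists:
  fixes h :: "'a::euclidean_space \<Rightarrow> ereal" and \<psi> :: "'a \<Rightarrow> real"
  assumes h: "proper_closed_convex h" and z0: "z0 \<in> edom h" and lam: "lam > 0"
    and cont: "continuous_on UNIV \<psi>" and S: "\<And>u. \<psi> u \<ge> \<psi> z0 - S * norm (u - z0)"
  obtains z where "z \<in> edom h"
    and "\<And>u. u \<in> edom h \<Longrightarrow> \<psi> z + real_of_ereal (h z) + 1 / (2 * lam) * (norm (z - z0))\<^sup>2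
           \<le> \<psi> u + real_of_ereal (h u) + 1 / (2 * lam) * (norm (u - z0))\<^sup>2"
proof -
  let ?r = "\<lambda>x. real_of_ereal (h x)"
  obtain A where A: "A \<ge> 0" "\<And>u. u \<in> edom h \<Longrightarrow> ?r u \<ge> ?r z0 - 1 - A * norm (u - z0)"
    using affine_minorant[OF h z0] by blast
  define G where "G = (\<lambda>(u, r). \<psi> u + r + 1 / (2 * lam) * (norm (u - z0))\<^sup>2)"
  have \<psi>fst: "continuous_on UNIV (\<lambda>x::'a \<times> real. \<psi> (fst x))"
    by (rule continuous_on_compose2[OF cont]) (auto intro!: continuous_intros)
  have Gcont: "continuous_on UNIV G"
    unfolding G_def case_prod_beta by (intro continuous_intros \<psi>fst)
  define K where "K = {p \<in> epi h. G p \<le> G (z0, ?r z0)}"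
  have G0: "G (z0, ?r z0) = \<psi> z0 + ?r z0" by (simp add: G_def)
  define c where "c = 2 * lam * (\<bar>S\<bar> + A)"
  \<comment> \<open>the radius that the quadratic inequality for \<open>\<parallel>u - z0\<parallel>\<close> below leads to\<close>
  define \<rho> where "\<rho> = sqrt (c\<^sup>2 + 4 * lam)"
  have epiD: "u \<in> edom h \<and> ?r u \<le> r" if "(u, r) \<in> epi h" for u r
  proof -
    have le: "h u \<le> ereal r" using that by (simp add: epi_def)
    then have u: "u \<in> edom h" by (auto simp: edom_def intro: le_less_trans)
    then show ?thesis using le ereal_real_on_edom[OF h u] by (metis ereal_less_eq(3))
  qed
  have Kbd: "norm (u - z0) \<le> \<rho> \<and> ?r z0 - 1 - A * \<rho> \<le> r \<and> r \<le> ?r z0 + \<bar>S\<bar> * \<rho>"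
    if "(u, r) \<in> K" for u r
  proof -
    define d where "d = norm (u - z0)"
    have d: "d \<ge> 0" by (simp add: d_def)
    have e: "(u, r) \<in> epi h" and G: "\<psi> u + r + 1 / (2 * lam) * d\<^sup>2 \<le> \<psi> z0 + ?r z0"
      using that G0 by (auto simp: K_def G_def d_def)
    have r: "?r z0 - 1 - A * d \<le> r" using epiD[OF e] A(2)[of u] by (auto simp: d_def)
    have "S * d \<le> \<bar>S\<bar> * d" using d by (intro mult_right_mono) auto
    then have Su: "\<psi> z0 - \<psi> u \<le> \<bar>S\<bar> * d" using S[of u] by (simp add: d_def)
    have "1 / (2 * lam) * d\<^sup>2 \<le> (\<bar>S\<bar> + A) * d + 1" using G r Su by (simp add: algebra_simps)
    then have "d\<^sup>2 \<le> c * d + 2 * lam" using lam by (simp add: field_simps c_def)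
    from square_le_of_quadratic[OF this] have "d\<^sup>2 \<le> c\<^sup>2 + 4 * lam" by simp
    then have d\<rho>: "d \<le> \<rho>" unfolding \<rho>_def by (rule real_le_rsqrt)
    have "A * d \<le> A * \<rho>" "\<bar>S\<bar> * d \<le> \<bar>S\<bar> * \<rho>" using d\<rho> A(1) by (auto intro: mult_left_mono)
    moreover have "0 \<le> 1 / (2 * lam) * d\<^sup>2" using lam by simp
    ultimately show ?thesis using d\<rho> r Su G unfolding d_def by linarith
  qed
  have "K \<subseteq> cball z0 \<rho> \<times> {?r z0 - 1 - A * \<rho> .. ?r z0 + \<bar>S\<bar> * \<rho>}"
    using Kbd by (auto simp: dist_norm norm_minus_commute)
  moreover have "compact (cball z0 \<rho> \<times> {?r z0 - 1 - A * \<rho> .. ?r z0 + \<bar>S\<bar> * \<rho>})"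
    by (intro compact_Times) auto
  moreover have "closed K"
  proof -
    have "K = epi h \<inter> {p. G p \<le> G (z0, ?r z0)}" by (auto simp: K_def)
    moreover have "closed (epi h)" using h by (simp add: proper_closed_convex_def)
    moreover have "closed {p. G p \<le> G (z0, ?r z0)}"
      by (intro closed_Collect_le Gcont continuous_intros)
    ultimately show ?thesis by auto
  qed
  ultimately have "compact K" by (metis closed_Int_compact inf.absorb1)
  moreover have "(z0, ?r z0) \<in> K" using ereal_real_on_edom[OF h z0] by (auto simp: K_def epi_def)
  ultimately obtain p where p: "p \<in> K" "\<And>q. q \<in> K \<Longrightarrow> G p \<le> G q"
    using continuous_attains_inf[of K G] continuous_on_subset[OF Gcont, of K] by blast
  obtain z r where zr: "p = (z, r)" by (cases p)
  have z: "z \<in> edom h" "?r z \<le> r" using p(1) zr epiD by (auto simp: K_def)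
  have Gz: "G (z, ?r z) \<le> G p" using z zr by (simp add: G_def)
  show ?thesis
  proof
    show "z \<in> edom h" by fact
    fix u assume u: "u \<in> edom h"
    have "G (z, ?r z) \<le> G (u, ?r u)"
    proof (cases "(u, ?r u) \<in> K")
      case True then show ?thesis using p(2) Gz by fastforce
    next
      case False
      then have "G (z0, ?r z0) < G (u, ?r u)"
        using ereal_real_on_edom[OF h u] by (auto simp: K_def epi_def)
      moreover have "G p \<le> G (z0, ?r z0)" using p(1) by (simp add: K_def)
      ultimately show ?thesis using Gz by linarith
    qed
    then show "\<psi> z + ?r z + 1 / (2 * lam) * (norm (z - z0))\<^sup>2
        \<le> \<psi> u + ?r u + 1 / (2 * lam) * (norm (u - z0))\<^sup>2" by (simp add: G_def)
  qed
qed

lemma norm_convex_combination: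
  fixes x y :: "'a::real_inner"
  shows "(norm ((1 - t) *\<^sub>R x + t *\<^sub>R y))\<^sup>2
    = (1 - t) * (norm x)\<^sup>2 + t * (norm y)\<^sup>2 - t * (1 - t) * (norm (y - x))\<^sup>2"
  by (simp add: power2_norm_eq_inner algebra_simps inner_commute)

text \<open>
  Comparing the minimizer with \<open>(1 - t) z + t u\<close> and letting \<open>t \<rightarrow> 0\<close> turns the strong
  convexity of the quadratic term into quadratic growth around \<open>z\<close>.
\<close>

lemma prox_strong_minimum:
  fixes h :: "'a::euclidean_space \<Rightarrow> ereal" and \<psi> :: "'a \<Rightarrow> real"
  assumes h: "proper_closed_convex h" and lam: "lam > 0" and conv: "convex_on UNIV \<psi>"
    and z: "z \<in> edom h"
    and min: "\<And>u. u \<in> edom h \<Longrightarrow> \<psi> z + real_of_ereal (h z) + 1 / (2 * lam) * (norm (z - z0))\<^sup>2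
           \<le> \<psi> u + real_of_ereal (h u) + 1 / (2 * lam) * (norm (u - z0))\<^sup>2"
    and u: "u \<in> edom h"
  shows "\<psi> z + real_of_ereal (h z) + 1 / (2 * lam) * (norm (z - z0))\<^sup>2 + 1 / (2 * lam) * (norm (u - z))\<^sup>2
           \<le> \<psi> u + real_of_ereal (h u) + 1 / (2 * lam) * (norm (u - z0))\<^sup>2"
proof -
  let ?G = "\<lambda>u. \<psi> u + real_of_ereal (h u) + 1 / (2 * lam) * (norm (u - z0))\<^sup>2"
  define c where "c = 1 / (2 * lam)"
  have "r * (c * (norm (u - z))\<^sup>2) \<le> ?G u - ?G z" if r: "0 < r" "r < 1" for r
  proof -
    define t where "t = 1 - r"
    have t: "0 < t" "t < 1" using r by (auto simp: t_def)
    let ?p = "(1 - t) *\<^sub>R z + t *\<^sub>R u"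
    have a: "\<psi> ?p \<le> (1 - t) * \<psi> z + t * \<psi> u" using convex_onD[OF conv, of t z u] t by simp
    have b: "real_of_ereal (h ?p) \<le> (1 - t) * real_of_ereal (h z) + t * real_of_ereal (h u)"
      and p: "?p \<in> edom h" using edom_convex_combination[OF h z u, of t] t by auto
    have e: "?p - z0 = (1 - t) *\<^sub>R (z - z0) + t *\<^sub>R (u - z0)" by (simp add: algebra_simps)
    have d: "c * (norm (?p - z0))\<^sup>2
       = (1 - t) * (c * (norm (z - z0))\<^sup>2) + t * (c * (norm (u - z0))\<^sup>2) - t * ((1 - t) * (c * (norm (u - z))\<^sup>2))"
      unfolding e norm_convex_combination by (simp add: algebra_simps)
    have "?G z \<le> ?G ?p" using min[OF p] .
    also have "\<dots> \<le> (1 - t) * ?G z + t * ?G u - t * ((1 - t) * (c * (norm (u - z))\<^sup>2))"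
      using a b d unfolding c_def by (simp only: distrib_left)
    finally have "t * ((1 - t) * (c * (norm (u - z))\<^sup>2)) \<le> t * (?G u - ?G z)"
      by (simp only: left_diff_distrib right_diff_distrib mult_1_left)
    then have "(1 - t) * (c * (norm (u - z))\<^sup>2) \<le> ?G u - ?G z" using t by (simp add: mult_le_cancel_left_pos)
    then show ?thesis by (simp add: t_def)
  qed
  then have "c * (norm (u - z))\<^sup>2 \<le> ?G u - ?G z" by (rule field_le_mult_one_interval)
  then show ?thesis by (simp add: c_def)
qed

text \<open>
  A minimizer is selected measurably as a limit of near-minimizers from a fixed countable set.
  Since \<open>h\<close> is only lower semicontinuous, a dense subset of its domain would not do; a countable
  dense subset of its epigraph does, because the objective is continuous there. The first
  index that is within \<open>1 / (n + 1)\<close> of optimal depends measurably on \<open>\<omega>\<close>, and quadratic growth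
  forces these points to converge to the minimizer.
\<close>

lemma prox_measurable:
  fixes h :: "'a::euclidean_space \<Rightarrow> ereal" and \<psi> :: "'w \<Rightarrow> 'a \<Rightarrow> real"
  assumes h: "proper_closed_convex h" and lam: "lam > 0"
    and meas: "\<And>u. (\<lambda>\<omega>. \<psi> \<omega> u) \<in> borel_measurable N"
    and cont: "\<And>\<omega>. continuous_on UNIV (\<psi> \<omega>)"
    and z: "\<And>\<omega>. \<omega> \<in> space N \<Longrightarrow> z \<omega> \<in> edom h"
    and min: "\<And>\<omega> u. \<omega> \<in> space N \<Longrightarrow> u \<in> edom h \<Longrightarrow>
       \<psi> \<omega> (z \<omega>) + real_of_ereal (h (z \<omega>)) + 1 / (2 * lam) * (norm (z \<omega> - z0))\<^sup>2
         + 1 / (2 * lam) * (norm (u - z \<omega>))\<^sup>2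
       \<le> \<psi> \<omega> u + real_of_ereal (h u) + 1 / (2 * lam) * (norm (u - z0))\<^sup>2"
  shows "z \<in> borel_measurable N"
proof -
  let ?r = "\<lambda>x. real_of_ereal (h x)"
  obtain T where T: "countable T" "T \<subseteq> epi h" "epi h \<subseteq> closure T"
    using separable[of "epi h"] by blast
  have "epi h \<noteq> {}"
  proof -
    obtain x where "x \<in> edom h" using h by (auto simp: proper_closed_convex_def)
    then have "(x, ?r x) \<in> epi h" using ereal_real_on_edom[OF h] by (auto simp: epi_def)
    then show ?thesis by auto
  qed
  then have Tne: "T \<noteq> {}" using T(3) by auto
  define q where "q = from_nat_into T"
  have rq: "range q = T" unfolding q_def by (rule range_from_nat_into[OF Tne T(1)])
  define val where "val \<omega> p = \<psi> \<omega> (fst p) + snd p + 1 / (2 * lam) * (norm (fst p - z0))\<^sup>2" for \<omega> and p :: "'a \<times> real"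
  have [measurable]: "(\<lambda>\<omega>. val \<omega> p) \<in> borel_measurable N" for p
    unfolding val_def by (intro borel_measurable_add meas) auto
  have vcont: "continuous_on UNIV (val \<omega>)" for \<omega>
    unfolding val_def
    by (intro continuous_intros continuous_on_compose2[OF cont]) auto
  have lower: "val \<omega> (z \<omega>, ?r (z \<omega>)) + 1 / (2 * lam) * (norm (fst p - z \<omega>))\<^sup>2 \<le> val \<omega> p"
    if "\<omega> \<in> space N" "p \<in> epi h" for \<omega> p
  proof -
    obtain u r where p: "p = (u, r)" by (cases p)
    have le: "h u \<le> ereal r" using that(2) p by (simp add: epi_def)
    then have u: "u \<in> edom h" by (auto simp: edom_def intro: le_less_trans)
    then have "?r u \<le> r" using le ereal_real_on_edom[OF h u] by (metis ereal_less_eq(3))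
    then show ?thesis using min[OF that(1) u] by (simp add: val_def p)
  qed
  have approx: "\<exists>i. val \<omega> (q i) < val \<omega> (z \<omega>, ?r (z \<omega>)) + e" if "\<omega> \<in> space N" "e > 0" for \<omega> e
  proof -
    let ?p = "(z \<omega>, ?r (z \<omega>))"
    have "?p \<in> epi h" using ereal_real_on_edom[OF h z[OF that(1)]] by (simp add: epi_def)
    then have "?p \<in> closure T" using T(3) by auto
    moreover have "open {p. val \<omega> p < val \<omega> ?p + e}"
      by (intro open_Collect_less vcont continuous_intros)
    moreover have "?p \<in> {p. val \<omega> p < val \<omega> ?p + e}" using that by simp
    ultimately have "\<exists>p\<in>T. val \<omega> p < val \<omega> ?p + e"
      unfolding closure_iff_nhds_not_empty by blast
    then show ?thesis using rq by (metis rangeE)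
  qed
  define good where "good n i \<omega> \<longleftrightarrow> (\<forall>k. val \<omega> (q i) \<le> val \<omega> (q k) + 1 / real (Suc n))" for n i \<omega>
  define \<kappa> where "\<kappa> n \<omega> = (LEAST i. good n i \<omega>)" for n \<omega>
  have "Measurable.pred N (good n i)" for n i
    unfolding good_def by measurable
  then have [measurable]: "\<kappa> n \<in> measurable N (count_space UNIV)" for n
    unfolding \<kappa>_def by (intro measurable_Least) auto
  have "(\<lambda>\<omega>. fst (q (\<kappa> n \<omega>))) \<in> borel_measurable N" for n
    by (rule measurable_compose[where f = "\<kappa> n" and N = "count_space UNIV"]) auto
  moreover have "(\<lambda>n. fst (q (\<kappa> n \<omega>))) \<longlonglongrightarrow> z \<omega>" if \<omega>: "\<omega> \<in> space N" for \<omega>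
  proof -
    let ?m = "val \<omega> (z \<omega>, ?r (z \<omega>))"
    have bd: "(norm (fst (q (\<kappa> n \<omega>)) - z \<omega>))\<^sup>2 \<le> 2 * lam * (1 / real (Suc n))" for n
    proof -
      obtain i where i: "val \<omega> (q i) < ?m + 1 / real (Suc n)" using approx[OF \<omega>, of "1 / real (Suc n)"] by auto
      have "q k \<in> epi h" for k using rq T(2) by auto
      note lo = lower[OF \<omega> this]
      have nn: "0 \<le> 1 / (2 * lam) * (norm (fst (q k) - z \<omega>))\<^sup>2" for k using lam by simp
      have "good n i \<omega>" unfolding good_def
      proof
        fix k show "val \<omega> (q i) \<le> val \<omega> (q k) + 1 / real (Suc n)" using i lo[of k] nn[of k] by linarith
      qed
      then have g: "good n (\<kappa> n \<omega>) \<omega>" unfolding \<kappa>_def by (rule LeastI)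
      have "val \<omega> (q (\<kappa> n \<omega>)) \<le> ?m + 1 / real (Suc n)"
      proof (rule field_le_epsilon)
        fix e :: real assume "e > 0"
        then obtain k where "val \<omega> (q k) < ?m + e" using approx[OF \<omega>] by blast
        then show "val \<omega> (q (\<kappa> n \<omega>)) \<le> ?m + 1 / real (Suc n) + e" using g unfolding good_def
          by (smt (verit))
      qed
      then have "1 / (2 * lam) * (norm (fst (q (\<kappa> n \<omega>)) - z \<omega>))\<^sup>2 \<le> 1 / real (Suc n)"
        using lo[of "\<kappa> n \<omega>"] by linarith
      then show ?thesis using lam by (simp add: field_simps)
    qed
    have lim: "(\<lambda>n. 2 * lam * (1 / real (Suc n))) \<longlonglongrightarrow> 0"
      using tendsto_mult_left[OF LIMSEQ_Suc[OF lim_1_over_n], of "2 * lam"] by simp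
    have "(\<lambda>n. (norm (fst (q (\<kappa> n \<omega>)) - z \<omega>))\<^sup>2) \<longlonglongrightarrow> 0"
    proof (rule tendsto_sandwich[OF _ _ tendsto_const lim])
      show "\<forall>\<^sub>F n in sequentially. (norm (fst (q (\<kappa> n \<omega>)) - z \<omega>))\<^sup>2 \<le> 2 * lam * (1 / real (Suc n))"
        by (rule always_eventually, rule allI, rule bd)
    qed simp
    then have "(\<lambda>n. sqrt ((norm (fst (q (\<kappa> n \<omega>)) - z \<omega>))\<^sup>2)) \<longlonglongrightarrow> sqrt 0"
      by (rule tendsto_real_sqrt)
    then have "(\<lambda>n. norm (fst (q (\<kappa> n \<omega>)) - z \<omega>)) \<longlonglongrightarrow> 0" by simp
    then show ?thesis using Lim_null[of _ "z \<omega>" sequentially] tendsto_norm_zero_iff by blast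
  qed
  ultimately show ?thesis by (rule borel_measurable_LIMSEQ_metric)
qed

section \<open>Damped averages with maxima\<close>

text \<open>
  The scalar form of the recursions of the method, up to an index shift by one: entry \<open>j\<close>
  of the sequence enters at iteration \<open>j + 1\<close>, which is why membership of \<open>Suc (Suc j)\<close> in \<open>B\<close>
  governs the step to \<open>Suc j\<close>. The models arise by applying it pointwise to the linearizations;
  with \<open>B = {}\<close> it is the plain damped average that defines \<open>u\<^sub>j\<close>.
\<close>

fun damped_max :: "real \<Rightarrow> nat set \<Rightarrow> (nat \<Rightarrow> real) \<Rightarrow> nat \<Rightarrow> real" where
  "damped_max \<beta> B y 0 = y 0"
| "damped_max \<beta> B y (Suc j) = (1 - \<beta>) * y (Suc j)
     + \<beta> * (if Suc (Suc j) \<in> B then max (damped_max \<beta> B y j) (y (Suc j)) else damped_max \<beta> B y j)"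

lemma damped_max_cong:
  assumes "\<And>i. i \<le> j \<Longrightarrow> y i = y' i"
  shows "damped_max \<beta> B y j = damped_max \<beta> B y' j"
  using assms by (induction j) auto

lemma damped_max_mono:
  assumes \<beta>: "0 \<le> \<beta>" "\<beta> \<le> 1" and "\<And>i. i \<le> j \<Longrightarrow> y i \<le> y' i"
  shows "damped_max \<beta> B y j \<le> damped_max \<beta> B y' j"
  using assms(3)
proof (induction j)
  case (Suc j)
  then have IH: "damped_max \<beta> B y j \<le> damped_max \<beta> B y' j" and y: "y (Suc j) \<le> y' (Suc j)" by auto
  have "(1 - \<beta>) * y (Suc j) \<le> (1 - \<beta>) * y' (Suc j)" using \<beta> y by (intro mult_left_mono) auto
  moreover have "\<beta> * max (damped_max \<beta> B y j) (y (Suc j)) \<le> \<beta> * max (damped_max \<beta> B y' j) (y' (Suc j))"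
    using \<beta> y IH by (intro mult_left_mono) auto
  moreover have "\<beta> * damped_max \<beta> B y j \<le> \<beta> * damped_max \<beta> B y' j"
    using \<beta> IH by (intro mult_left_mono) auto
  ultimately show ?case by auto
qed simp

lemma damped_max_translate:
  "damped_max \<beta> B (\<lambda>i. y i + c) j = damped_max \<beta> B y j + c"
proof (induction j)
  case (Suc j)
  have "max (damped_max \<beta> B y j + c) (y (Suc j) + c) = max (damped_max \<beta> B y j) (y (Suc j)) + c" by simp
  then show ?case using Suc by (simp add: algebra_simps)
qed simp

text \<open>
  A map that is monotone and commutes with adding constants is nonexpansive in the sup norm.
\<close>

lemma damped_max_nonexpansive:
  assumes \<beta>: "0 \<le> \<beta>" "\<beta> \<le> 1" and "\<And>i. i \<le> j \<Longrightarrow> \<bar>y i - y' i\<bar> \<le> c"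
  shows "\<bar>damped_max \<beta> B y j - damped_max \<beta> B y' j\<bar> \<le> c"
proof -
  have "damped_max \<beta> B y j \<le> damped_max \<beta> B (\<lambda>i. y' i + c) j"
    "damped_max \<beta> B y' j \<le> damped_max \<beta> B (\<lambda>i. y i + c) j"
    using assms by (auto intro!: damped_max_mono simp: abs_le_iff algebra_simps)
  then show ?thesis unfolding damped_max_translate by linarith
qed

lemma damped_max_convex_combination:
  assumes \<beta>: "0 \<le> \<beta>" "\<beta> \<le> 1" and t: "0 \<le> t" "t \<le> 1"
  shows "damped_max \<beta> B (\<lambda>i. (1 - t) * y i + t * y' i) j
    \<le> (1 - t) * damped_max \<beta> B y j + t * damped_max \<beta> B y' j"
proof (induction j)
  case (Suc j)
  let ?c = "\<lambda>i. (1 - t) * y i + t * y' i" and ?m = "\<lambda>y. max (damped_max \<beta> B y j) (y (Suc j))"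
  have "(1 - t) * damped_max \<beta> B y j \<le> (1 - t) * ?m y" "t * damped_max \<beta> B y' j \<le> t * ?m y'"
    "(1 - t) * y (Suc j) \<le> (1 - t) * ?m y" "t * y' (Suc j) \<le> t * ?m y'"
    using t by (auto intro!: mult_left_mono)
  then have "?m ?c \<le> (1 - t) * ?m y + t * ?m y'" using Suc by linarith
  then have "\<beta> * ?m ?c \<le> \<beta> * ((1 - t) * ?m y + t * ?m y')" using \<beta> by (intro mult_left_mono)
  moreover have "\<beta> * damped_max \<beta> B ?c j \<le> \<beta> * ((1 - t) * damped_max \<beta> B y j + t * damped_max \<beta> B y' j)"
    using Suc \<beta> by (intro mult_left_mono)
  ultimately show ?case by (simp add: algebra_simps split del: if_split split: if_split_asm) (simp add: algebra_simps)
qed simp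

lemma damped_max_measurable [measurable]:
  assumes "\<And>i. i \<le> j \<Longrightarrow> (\<lambda>\<omega>. y \<omega> i) \<in> borel_measurable N"
  shows "(\<lambda>\<omega>. damped_max \<beta> B (y \<omega>) j) \<in> borel_measurable N"
  using assms
proof (induction j)
  case (Suc j)
  then have [measurable]: "(\<lambda>\<omega>. damped_max \<beta> B (y \<omega>) j) \<in> borel_measurable N"
    "(\<lambda>\<omega>. y \<omega> (Suc j)) \<in> borel_measurable N" by auto
  show ?case by (cases "Suc (Suc j) \<in> B") simp_all
qed simp

lemma damped_max_integrable:
  assumes "\<And>i. i \<le> j \<Longrightarrow> integrable N (\<lambda>\<omega>. y \<omega> i)"
  shows "integrable N (\<lambda>\<omega>. damped_max \<beta> B (y \<omega>) j)"
  using assms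
proof (induction j)
  case (Suc j)
  then have "integrable N (\<lambda>\<omega>. damped_max \<beta> B (y \<omega>) j)" "integrable N (\<lambda>\<omega>. y \<omega> (Suc j))" by auto
  then show ?case by (cases "Suc (Suc j) \<in> B") simp_all
qed simp

lemma integral_damped_avg:
  assumes "\<And>i. i \<le> j \<Longrightarrow> integrable N (\<lambda>\<omega>. y \<omega> i)"
  shows "(\<integral>\<omega>. damped_max \<beta> {} (y \<omega>) j \<partial>N) = damped_max \<beta> {} (\<lambda>i. \<integral>\<omega>. y \<omega> i \<partial>N) j"
  using assms
proof (induction j)
  case (Suc j)
  have "integrable N (\<lambda>\<omega>. damped_max \<beta> {} (y \<omega>) j)" using Suc.prems by (intro damped_max_integrable) auto
  moreover have "integrable N (\<lambda>\<omega>. y \<omega> (Suc j))" using Suc.prems by auto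
  ultimately show ?case using Suc by simp
qed simp

section \<open>Pathwise analysis\<close>

lemma ln_le_half:
  fixes x :: real
  assumes "x > 0"
  shows "ln x \<le> x / 2"
proof -
  have "ln x = 2 * ln (sqrt x)" using assms by (simp add: ln_sqrt)
  also have "\<dots> \<le> 2 * (sqrt x - 1)" using assms ln_le_minus_one[of "sqrt x"] by simp
  also have "\<dots> \<le> x / 2"
  proof -
    have "0 \<le> (sqrt x - 2)\<^sup>2" by simp
    then show ?thesis using assms by (simp add: power2_diff)
  qed
  finally show ?thesis .
qed

lemma smax_beta_bounds:
  assumes "I \<ge> 1"
  shows "0 < smax_beta I" "smax_beta I < 1"
proof -
  define L where "L = ln (real I + 1)"
  have "0 < L" using assms by (simp add: L_def)
  moreover have "L \<le> (real I + 1) / 2" unfolding L_def by (intro ln_le_half) simp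
  moreover have "smax_beta I = (real I + 1 - L) / (real I + 1 + L)" by (simp add: smax_beta_def L_def)
  ultimately show "0 < smax_beta I" "smax_beta I < 1" by simp_all
qed

lemma young_product:
  fixes n d c :: real
  assumes "c > 0"
  shows "n * d \<le> c * n\<^sup>2 + d\<^sup>2 / (4 * c)"
proof -
  have "0 \<le> (2 * c * n - d)\<^sup>2" by simp
  then have "4 * c * (n * d) \<le> 4 * c * (c * n\<^sup>2) + d\<^sup>2"
    by (simp add: power2_diff power2_eq_square algebra_simps)
  also have "\<dots> = 4 * c * (c * n\<^sup>2 + d\<^sup>2 / (4 * c))" using assms by (simp add: distrib_left)
  finally show ?thesis using assms by simp
qed

locale smax1c =
  fixes F :: "'a::euclidean_space \<Rightarrow> 'b \<Rightarrow> real"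
    and s :: "'a \<Rightarrow> 'b \<Rightarrow> 'a"
    and h :: "'a \<Rightarrow> ereal"
    and lam :: real
    and I :: nat
    and B :: "nat set"
    and z0 :: 'a
  assumes h: "proper_closed_convex h" and z0: "z0 \<in> edom h" and lam: "lam > 0" and I: "I \<ge> 2"
begin

abbreviation "hr x \<equiv> real_of_ereal (h x)"
abbreviation "\<beta> \<equiv> smax_beta I"
abbreviation "Z \<equiv> smax_z F s h lam I B z0"
abbreviation "sg w i \<equiv> s (Z w i) (w i)"

lemma beta: "0 < \<beta>" "\<beta> < 1" "0 \<le> \<beta>" "\<beta> \<le> 1" "0 < 1 - \<beta>" "0 \<le> 1 - \<beta>"
  using smax_beta_bounds[of I] I by auto

definition lin :: "(nat \<Rightarrow> 'b) \<Rightarrow> nat \<Rightarrow> 'a \<Rightarrow> real" where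
  "lin w i u = F (Z w i) (w i) + sg w i \<bullet> (u - Z w i)"

text \<open>
  The finite part of the model: after the samples \<open>w 0, \<dots>, w j\<close> the model is
  \<open>\<Gamma>\<^sub>j\<^sub>+\<^sub>1 = psi w j + h\<close>. The composite term \<open>h\<close> splits off because the linearizations
  are combined with total weight one and a maximum commutes with adding a common term.
\<close>

definition psi :: "(nat \<Rightarrow> 'b) \<Rightarrow> nat \<Rightarrow> 'a \<Rightarrow> real" where
  "psi w j u = damped_max \<beta> B (\<lambda>i. lin w i u) j"

lemma psi_Suc: "psi w (Suc j) u = (1 - \<beta>) * lin w (Suc j) u
     + \<beta> * (if Suc (Suc j) \<in> B then max (psi w j u) (lin w (Suc j) u) else psi w j u)"
  by (simp add: psi_def)

lemma Gamma_eq: "smax_Gamma F s h lam I B z0 w (Suc j) u = ereal (psi w j u) + h u"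
proof (induction j arbitrary: u)
  case 0
  show ?case
    by (cases "h u") (auto simp: ell_def psi_def lin_def)
next
  case (Suc j)
  have ell: "ell F s h (Z w (Suc j)) (w (Suc j)) u = ereal (lin w (Suc j) u) + h u"
    by (cases "h u") (auto simp: ell_def lin_def)
  have eq: "smax_Gamma F s h lam I B z0 w (Suc (Suc j)) u =
      (if Suc (Suc j) \<in> B
         then ereal (1 - \<beta>) * (ereal (lin w (Suc j) u) + h u)
           + ereal \<beta> * max (ereal (psi w j u) + h u) (ereal (lin w (Suc j) u) + h u)
         else ereal (1 - \<beta>) * (ereal (lin w (Suc j) u) + h u) + ereal \<beta> * (ereal (psi w j u) + h u))"
    by (simp del: smax_z.simps add: Let_def ell Suc)
  show ?case
  proof (cases "h u")
    case (real r)
    have m: "max (psi w j u + r) (lin w (Suc j) u + r) = max (psi w j u) (lin w (Suc j) u) + r" by simp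
    show ?thesis unfolding eq psi_Suc real
      by (simp add: ereal_max[symmetric] m del: ereal_max) (simp add: algebra_simps)
  next
    case PInf then show ?thesis unfolding eq using beta by simp
  next
    case MInf then show ?thesis using proper_closed_convex_not_MInf[OF h, of u] by simp
  qed
qed

lemma lin_diff: "lin w i u - lin w i v = sg w i \<bullet> (u - v)"
  by (simp add: lin_def inner_diff_right)

lemma psi_lipschitz: "\<bar>psi w j u - psi w j v\<bar> \<le> (\<Sum>i\<le>j. norm (sg w i)) * norm (u - v)"
  unfolding psi_def
proof (rule damped_max_nonexpansive)
  fix i assume "i \<le> j"
  have "\<bar>lin w i u - lin w i v\<bar> \<le> norm (sg w i) * norm (u - v)"
    unfolding lin_diff by (rule Cauchy_Schwarz_ineq2)
  also have "\<dots> \<le> (\<Sum>i\<le>j. norm (sg w i)) * norm (u - v)"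
    using \<open>i \<le> j\<close> by (intro mult_right_mono member_le_sum) auto
  finally show "\<bar>lin w i u - lin w i v\<bar> \<le> (\<Sum>i\<le>j. norm (sg w i)) * norm (u - v)" .
qed (use beta in auto)

lemma psi_continuous: "continuous_on UNIV (psi w j)"
proof -
  have "(\<Sum>i\<le>j. norm (sg w i))-lipschitz_on UNIV (psi w j)"
    by (intro lipschitz_onI) (use psi_lipschitz in \<open>auto simp: dist_real_def dist_norm intro: sum_nonneg\<close>)
  then show ?thesis by (rule lipschitz_on_continuous_on)
qed

lemma psi_convex: "convex_on UNIV (psi w j)"
proof (rule convex_onI)
  fix t :: real and x y assume t: "0 < t" "t < 1"
  have "lin w i ((1 - t) *\<^sub>R x + t *\<^sub>R y) = (1 - t) * lin w i x + t * lin w i y" for i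
    by (simp add: lin_def algebra_simps)
  then show "psi w j ((1 - t) *\<^sub>R x + t *\<^sub>R y) \<le> (1 - t) * psi w j x + t * psi w j y"
    unfolding psi_def using damped_max_convex_combination[of \<beta> t B "\<lambda>i. lin w i x" "\<lambda>i. lin w i y" j] beta t
    by simp
qed simp

text \<open>
  The defining \<open>ARG_MIN\<close> is attained, so it picks an actual minimizer; since the model is infinite
  outside \<open>edom h\<close>, comparison with \<open>z0\<close> places the minimizer in \<open>edom h\<close>.
\<close>

lemma Z_prox:
  shows "Z w (Suc j) \<in> edom h"
    and "u \<in> edom h \<Longrightarrow> psi w j (Z w (Suc j)) + hr (Z w (Suc j)) + 1 / (2 * lam) * (norm (Z w (Suc j) - z0))\<^sup>2
      \<le> psi w j u + hr u + 1 / (2 * lam) * (norm (u - z0))\<^sup>2"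
proof -
  let ?G = "\<lambda>u. smax_Gamma F s h lam I B z0 w (Suc j) u + ereal (1 / (2 * lam) * (norm (u - z0))\<^sup>2)"
  let ?g = "\<lambda>u. psi w j u + hr u + 1 / (2 * lam) * (norm (u - z0))\<^sup>2"
  have lower: "psi w j u \<ge> psi w j z0 - (\<Sum>i\<le>j. norm (sg w i)) * norm (u - z0)" for u
    using psi_lipschitz[of w j u z0] by linarith
  obtain z where z: "z \<in> edom h" and min: "\<And>u. u \<in> edom h \<Longrightarrow> ?g z \<le> ?g u"
    using prox_exists[OF h z0 lam psi_continuous lower] by blast
  have fin: "?G u = ereal (?g u)" if "u \<in> edom h" for u
  proof -
    obtain r where "h u = ereal r" by (rule that[OF ereal_real_on_edom[OF h \<open>u \<in> edom h\<close>, symmetric]])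
    then show ?thesis unfolding Gamma_eq by simp
  qed
  have inf: "?G u = \<infinity>" if "u \<notin> edom h" for u
    using that unfolding Gamma_eq by (simp add: edom_def)
  have "\<not> ?G y < ?G z" for y
    using fin[OF z] fin[of y] inf[of y] min[of y] by (cases "y \<in> edom h") auto
  then have "is_arg_min ?G (\<lambda>_. True) z" unfolding is_arg_min_def by blast
  then have "is_arg_min ?G (\<lambda>_. True) (Z w (Suc j))"
    unfolding smax_z.simps arg_min_def by (rule someI)
  then have am: "\<not> ?G y < ?G (Z w (Suc j))" for y unfolding is_arg_min_def by blast
  show Z: "Z w (Suc j) \<in> edom h"
  proof (rule ccontr)
    assume "Z w (Suc j) \<notin> edom h"
    then have "?G (Z w (Suc j)) = \<infinity>" by (rule inf)
    then show False using am[of z] fin[OF z] by simp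
  qed
  assume u: "u \<in> edom h"
  show "?g (Z w (Suc j)) \<le> ?g u" using am[of u] fin[OF Z] fin[OF u] by simp
qed

lemma Z_edom: "Z w j \<in> edom h"
  by (cases j) (simp_all add: z0 Z_prox del: smax_z.simps(2))

lemma Z_strong:
  assumes "u \<in> edom h"
  shows "psi w j (Z w (Suc j)) + hr (Z w (Suc j)) + 1 / (2 * lam) * (norm (Z w (Suc j) - z0))\<^sup>2
        + 1 / (2 * lam) * (norm (u - Z w (Suc j)))\<^sup>2
      \<le> psi w j u + hr u + 1 / (2 * lam) * (norm (u - z0))\<^sup>2"
  by (rule prox_strong_minimum[OF h lam psi_convex Z_edom Z_prox(2) assms])

lemma Z_cong:
  assumes "\<And>i. i < k \<Longrightarrow> w i = w' i"
  shows "Z w k = Z w' k"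
  using assms
proof (induction k rule: less_induct)
  case (less k)
  show ?case
  proof (cases k)
    case (Suc j)
    have "lin w i u = lin w' i u" if "i \<le> j" for i u
    proof -
      have "Z w i = Z w' i" "w i = w' i" using less Suc that by auto
      then show ?thesis by (simp add: lin_def)
    qed
    then have "psi w j u = psi w' j u" for u unfolding psi_def by (intro damped_max_cong) auto
    then have "smax_Gamma F s h lam I B z0 w (Suc j) = smax_Gamma F s h lam I B z0 w' (Suc j)"
      by (simp add: fun_eq_iff Gamma_eq)
    then show ?thesis by (simp only: Suc smax_z.simps)
  qed simp
qed

text \<open>
  The samples are an arbitrary measurable process \<open>X\<close>. This serves twice: for the given samples on
  \<open>\<Omega>\<close>, and for the coordinate process on a product space that carries only the earlier samples.
\<close>

lemma Z_measurable:
  assumes F_meas: "(\<lambda>(x, v). F x v) \<in> borel_measurable (restrict_space borel (edom h) \<Otimes>\<^sub>M P)"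
    and s_meas: "(\<lambda>(x, v). s x v) \<in> borel_measurable (restrict_space borel (edom h) \<Otimes>\<^sub>M P)"
    and X: "\<And>i. i < k \<Longrightarrow> (\<lambda>\<omega>. X \<omega> i) \<in> measurable N P"
  shows "(\<lambda>\<omega>. Z (X \<omega>) k) \<in> measurable N (restrict_space borel (edom h))"
  using X
proof (induction k rule: less_induct)
  case (less k)
  show ?case
  proof (cases k)
    case 0
    then show ?thesis using z0 by (auto intro!: measurable_restrict_space2)
  next
    case (Suc j)
    have lin: "(\<lambda>\<omega>. lin (X \<omega>) i u) \<in> borel_measurable N" if "i \<le> j" for i u
    proof -
      have Zm: "(\<lambda>\<omega>. Z (X \<omega>) i) \<in> measurable N (restrict_space borel (edom h))"
        and Xm: "(\<lambda>\<omega>. X \<omega> i) \<in> measurable N P" using less Suc that by auto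
      have [measurable]: "(\<lambda>\<omega>. F (Z (X \<omega>) i) (X \<omega> i)) \<in> borel_measurable N"
        using measurable_compose[OF measurable_Pair[OF Zm Xm] F_meas] by simp
      have [measurable]: "(\<lambda>\<omega>. s (Z (X \<omega>) i) (X \<omega> i)) \<in> borel_measurable N"
        using measurable_compose[OF measurable_Pair[OF Zm Xm] s_meas] by simp
      have [measurable]: "(\<lambda>\<omega>. Z (X \<omega>) i) \<in> borel_measurable N"
        using Zm by (simp add: measurable_restrict_space2_iff)
      show ?thesis unfolding lin_def by measurable
    qed
    have psi: "(\<lambda>\<omega>. psi (X \<omega>) j u) \<in> borel_measurable N" for u
      unfolding psi_def by (intro damped_max_measurable lin)
    have "(\<lambda>\<omega>. Z (X \<omega>) (Suc j)) \<in> borel_measurable N"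
      by (rule prox_measurable[OF h lam psi psi_continuous Z_edom Z_strong])
    then show ?thesis unfolding Suc by (intro measurable_restrict_space2) (auto simp del: smax_z.simps(2) intro: Z_edom)
  qed
qed


text \<open>
  The subgradient property holds for almost every sample only; this is the exceptional-set-free
  condition on a realization under which the pathwise estimates are valid.
\<close>

definition samples_ok :: "(nat \<Rightarrow> 'b) \<Rightarrow> bool" where
  "samples_ok w \<longleftrightarrow> (\<forall>i\<le>I. \<forall>x\<in>edom h. s x (w i) \<in> subdifferential (edom h) (\<lambda>x. F x (w i)) x)"

lemma samples_okD:
  assumes "samples_ok w" "i \<le> I" "x \<in> edom h" "u \<in> edom h"
  shows "F x (w i) + s x (w i) \<bullet> (u - x) \<le> F u (w i)"
  using assms by (auto simp: samples_ok_def subdifferential_def)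

text \<open>
  At a fixed point \<open>u\<close> each linearization lies below \<open>F u\<close>, and the aggregation is monotone. The
  bound on the right depends on the samples only through the values \<open>F u (w i)\<close>, no longer
  through the iterates.
\<close>

lemma psi_le_damped_max:
  assumes "samples_ok w" "j \<le> I" "u \<in> edom h"
  shows "psi w j u \<le> damped_max \<beta> B (\<lambda>i. F u (w i)) j"
  unfolding psi_def lin_def
  using assms beta by (intro damped_max_mono samples_okD) (auto simp del: smax_z.simps(2) intro: Z_edom)

definition step_cost :: "(nat \<Rightarrow> 'b) \<Rightarrow> nat \<Rightarrow> real" where
  "step_cost w j = F (Z w (Suc j)) (w (Suc j)) + hr (Z w (Suc j))"

lemma smax_u_eq: "smax_u F s h lam I B z0 w (Suc j) = ereal (damped_max \<beta> {} (step_cost w) j)"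
proof (induction j)
  case 0
  show ?case using ereal_real_on_edom[OF h Z_edom[of w 1]]
    by (simp add: Phi_def step_cost_def del: smax_z.simps flip: plus_ereal.simps(1))
next
  case (Suc j)
  have "Phi F h (Z w (Suc (Suc j))) (w (Suc (Suc j))) = ereal (step_cost w (Suc j))"
    using ereal_real_on_edom[OF h Z_edom[of w "Suc (Suc j)"]]
    by (simp add: Phi_def step_cost_def del: smax_z.simps flip: plus_ereal.simps(1))
  then show ?case using Suc by (simp del: smax_z.simps)
qed

text \<open>
  The optimal value \<open>m\<^sub>j\<^sub>+\<^sub>1\<close> of the regularized model whose minimizer is \<open>Z w (Suc j)\<close>.
\<close>

definition model_min :: "(nat \<Rightarrow> 'b) \<Rightarrow> nat \<Rightarrow> real" where
  "model_min w j = psi w j (Z w (Suc j)) + hr (Z w (Suc j)) + 1 / (2 * lam) * (norm (Z w (Suc j) - z0))\<^sup>2"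

text \<open>
  The price of linearizing at \<open>z\<^sub>j\<close> instead of evaluating at \<open>z\<^sub>j\<^sub>+\<^sub>1\<close>. The difference of the two
  \<open>F\<close> values has mean zero, since \<open>z\<^sub>j\<close> is independent of both samples. The weight of the
  squared subgradients is what Young's inequality leaves after the quadratic term available at
  that step has been spent: all of \<open>\<parallel>z\<^sub>1 - z\<^sub>0\<parallel>\<^sup>2 / (2 lam)\<close> at the first step, and the fraction
  \<open>\<beta>\<close> of \<open>\<parallel>z\<^sub>j\<^sub>+\<^sub>1 - z\<^sub>j\<parallel>\<^sup>2 / (2 lam)\<close>, divided by \<open>1 - \<beta>\<close>, at later ones.
\<close>

definition step_error :: "(nat \<Rightarrow> 'b) \<Rightarrow> nat \<Rightarrow> real" where
  "step_error w j = F (Z w j) (w (Suc j)) - F (Z w j) (w j)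
     + (if j = 0 then lam else (1 - \<beta>) * lam / \<beta>) * ((norm (sg w j))\<^sup>2 + (norm (sg w (Suc j)))\<^sup>2)"

text \<open>
  The true cost at \<open>z\<^sub>j\<^sub>+\<^sub>1\<close> exceeds its linearization from \<open>z\<^sub>j\<close> by a sampling difference plus two
  inner products of a subgradient with \<open>z\<^sub>j\<^sub>+\<^sub>1 - z\<^sub>j\<close>, one for each end point; Young's inequality
  trades each of them for a squared norm and half of the quadratic term.
\<close>

lemma step_cost_le:
  assumes ok: "samples_ok w" and j: "Suc j \<le> I" and c: "c > 0"
  shows "step_cost w j \<le> lin w j (Z w (Suc j)) + hr (Z w (Suc j)) + (norm (Z w (Suc j) - Z w j))\<^sup>2 / (2 * c)
    + (F (Z w j) (w (Suc j)) - F (Z w j) (w j)) + c * ((norm (sg w j))\<^sup>2 + (norm (sg w (Suc j)))\<^sup>2)"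
proof -
  define z z' where "z = Z w j" and "z' = Z w (Suc j)"
  define g g' where "g = sg w j" and "g' = sg w (Suc j)"
  define d where "d = norm (z' - z)"
  have "F z' (w (Suc j)) + g' \<bullet> (z - z') \<le> F z (w (Suc j))"
    unfolding z_def z'_def g'_def by (intro samples_okD ok j Z_edom)
  moreover have "- (g' \<bullet> (z - z')) \<le> norm g' * d"
    using norm_cauchy_schwarz[of g' "z' - z"] by (simp add: d_def inner_diff_right)
  moreover have "- (g \<bullet> (z' - z)) \<le> norm g * d"
    using norm_cauchy_schwarz[of "- g" "z' - z"] by (simp add: d_def)
  moreover have "norm g' * d \<le> c * (norm g')\<^sup>2 + d\<^sup>2 / (4 * c)" "norm g * d \<le> c * (norm g)\<^sup>2 + d\<^sup>2 / (4 * c)"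
    using c by (auto intro: young_product)
  moreover have "d\<^sup>2 / (2 * c) = d\<^sup>2 / (4 * c) + d\<^sup>2 / (4 * c)" by simp
  moreover have "lin w j z' = F z (w j) + g \<bullet> (z' - z)" by (simp add: lin_def z_def g_def)
  moreover have "step_cost w j = F z' (w (Suc j)) + hr z'" by (simp add: step_cost_def z'_def del: smax_z.simps)
  ultimately have "step_cost w j \<le> lin w j z' + hr z' + d\<^sup>2 / (2 * c)
      + (F z (w (Suc j)) - F z (w j)) + c * ((norm g)\<^sup>2 + (norm g')\<^sup>2)"
    unfolding distrib_left by linarith
  then show ?thesis unfolding z_def z'_def g_def g'_def d_def .
qed

text \<open>
  The new model dominates \<open>(1 - \<beta>)\<close> times the new linearization plus \<open>\<beta>\<close> times the old model,
  whether or not a maximum is taken, and the old regularized model grows quadratically around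
  its minimizer.
\<close>

lemma model_min_Suc:
  "(1 - \<beta>) * (lin w (Suc j) (Z w (Suc (Suc j))) + hr (Z w (Suc (Suc j)))) + \<beta> * model_min w j
     + \<beta> / (2 * lam) * (norm (Z w (Suc (Suc j)) - Z w (Suc j)))\<^sup>2 \<le> model_min w (Suc j)"
proof -
  define z z' where "z = Z w (Suc j)" and "z' = Z w (Suc (Suc j))"
  define q where "q = 1 / (2 * lam) * (norm (z' - z0))\<^sup>2"
  have "0 \<le> (1 - \<beta>) * q" using lam beta by (simp add: q_def)
  have "model_min w j + 1 / (2 * lam) * (norm (z' - z))\<^sup>2 \<le> psi w j z' + hr z' + q"
    unfolding model_min_def q_def z_def z'_def by (rule Z_strong[OF Z_edom])
  then have "\<beta> * (model_min w j + 1 / (2 * lam) * (norm (z' - z))\<^sup>2) \<le> \<beta> * (psi w j z' + hr z' + q)"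
    using beta by (intro mult_left_mono) auto
  moreover have "(1 - \<beta>) * lin w (Suc j) z' + \<beta> * psi w j z' \<le> psi w (Suc j) z'"
    unfolding psi_Suc using beta by (auto intro!: mult_left_mono)
  moreover have "model_min w (Suc j) = psi w (Suc j) z' + hr z' + q" by (simp add: model_min_def z'_def q_def)
  ultimately have "(1 - \<beta>) * (lin w (Suc j) z' + hr z') + \<beta> * model_min w j + \<beta> / (2 * lam) * (norm (z' - z))\<^sup>2
     \<le> model_min w (Suc j)"
    using \<open>0 \<le> (1 - \<beta>) * q\<close> by (simp add: algebra_simps)
  then show ?thesis unfolding z_def z'_def .
qed

text \<open>
  The gap \<open>u\<^sub>j - m\<^sub>j\<close> obeys the same damped recursion as the output \<open>u\<^sub>j\<close>: the quadratic growth
  in \<open>model_min_Suc\<close> pays for the quadratic term in \<open>step_cost_le\<close>.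
\<close>

lemma gap_le_error:
  assumes ok: "samples_ok w"
  shows "Suc j \<le> I \<Longrightarrow> damped_max \<beta> {} (step_cost w) j \<le> model_min w j + damped_max \<beta> {} (step_error w) j"
proof (induction j)
  case 0
  have "step_cost w 0 \<le> lin w 0 (Z w 1) + hr (Z w 1) + (norm (Z w 1 - z0))\<^sup>2 / (2 * lam) + step_error w 0"
    using step_cost_le[OF ok 0 lam] by (simp add: step_error_def del: smax_z.simps(2))
  then show ?case by (simp add: model_min_def psi_def del: smax_z.simps)
next
  case (Suc j)
  define c where "c = (1 - \<beta>) * lam / \<beta>"
  have c: "c > 0" using lam beta by (simp add: c_def)
  let ?z = "Z w (Suc j)" and ?z' = "Z w (Suc (Suc j))"
  let ?d = "(norm (?z' - ?z))\<^sup>2"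
  have "step_cost w (Suc j) \<le> lin w (Suc j) ?z' + hr ?z' + ?d / (2 * c) + step_error w (Suc j)"
    using step_cost_le[OF ok Suc.prems c] by (simp add: step_error_def c_def del: smax_z.simps)
  then have "(1 - \<beta>) * step_cost w (Suc j) \<le> (1 - \<beta>) * (lin w (Suc j) ?z' + hr ?z' + ?d / (2 * c) + step_error w (Suc j))"
    using beta by (intro mult_left_mono) auto
  moreover have "(1 - \<beta>) * (?d / (2 * c)) = \<beta> / (2 * lam) * ?d" using beta lam by (simp add: c_def)
  moreover have "\<beta> * damped_max \<beta> {} (step_cost w) j \<le> \<beta> * (model_min w j + damped_max \<beta> {} (step_error w) j)"
    using Suc beta by (intro mult_left_mono) auto
  ultimately show ?case using model_min_Suc[of w j] by (simp add: distrib_left del: smax_z.simps)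
qed

text \<open>
  The optimal value of the regularized model is at most its value at \<open>u\<close>, which brings in the
  distance \<open>\<parallel>u - z0\<parallel>\<close> and the aggregated sample values at \<open>u\<close>. For \<open>u = x\<^sub>*\<close> this is the
  pathwise form of the final bound.
\<close>

lemma output_gap_le:
  assumes ok: "samples_ok w" and u: "u \<in> edom h" and j: "Suc j \<le> I"
  shows "damped_max \<beta> {} (step_cost w) j
    \<le> damped_max \<beta> B (\<lambda>i. F u (w i)) j + hr u + 1 / (2 * lam) * (norm (u - z0))\<^sup>2 + damped_max \<beta> {} (step_error w) j"
proof -
  have "model_min w j \<le> psi w j u + hr u + 1 / (2 * lam) * (norm (u - z0))\<^sup>2"
    unfolding model_min_def by (rule Z_prox(2)[OF u])
  moreover have "psi w j u \<le> damped_max \<beta> B (\<lambda>i. F u (w i)) j" using j by (intro psi_le_damped_max ok u) auto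
  ultimately show ?thesis using gap_le_error[OF ok j] by linarith
qed

text \<open>
  A priori bounds by the norms of the earlier subgradients. Quantitatively they are crude;
  their purpose is the integrability of everything that depends on the iterates. They come from
  comparing the proximal objective at \<open>z\<^sub>j\<close> and at \<open>z0\<close> and using the affine minorant of \<open>h\<close>.
\<close>

lemma Z_bounds:
  obtains A where "A \<ge> 0"
    and "\<And>w j. (norm (Z w j - z0))\<^sup>2 \<le> lam\<^sup>2 * ((\<Sum>i<j. norm (sg w i)) + A)\<^sup>2 + 2 * lam"
    and "\<And>w j. \<bar>hr (Z w j) - hr z0\<bar> \<le> 1 + ((\<Sum>i<j. norm (sg w i)) + A) * norm (Z w j - z0)"
proof -
  obtain A where A: "A \<ge> 0" "\<And>u. u \<in> edom h \<Longrightarrow> hr u \<ge> hr z0 - 1 - A * norm (u - z0)"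
    using affine_minorant[OF h z0] by blast
  have main: "(norm (Z w j - z0))\<^sup>2 \<le> lam\<^sup>2 * ((\<Sum>i<j. norm (sg w i)) + A)\<^sup>2 + 2 * lam
     \<and> \<bar>hr (Z w j) - hr z0\<bar> \<le> 1 + ((\<Sum>i<j. norm (sg w i)) + A) * norm (Z w j - z0)" for w j
  proof (cases j)
    case 0
    then show ?thesis using lam by simp
  next
    case (Suc k)
    define z where "z = Z w j"
    define S where "S = (\<Sum>i<j. norm (sg w i))"
    define d where "d = norm (z - z0)"
    define q where "q = 1 / (2 * lam) * d\<^sup>2"
    have S: "0 \<le> S" unfolding S_def by (intro sum_nonneg) simp
    have q: "q \<ge> 0" "d \<ge> 0" using lam by (simp_all add: q_def d_def)
    have "psi w k z + hr z + q + q \<le> psi w k z0 + hr z0"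
      using Z_strong[OF z0, of w k] by (simp add: q_def d_def z_def Suc norm_minus_commute del: smax_z.simps)
    moreover have "\<bar>psi w k z - psi w k z0\<bar> \<le> S * d"
      using psi_lipschitz[of w k z z0] by (simp add: S_def d_def Suc lessThan_Suc_atMost)
    moreover have lo: "hr z \<ge> hr z0 - 1 - A * d" unfolding d_def z_def by (intro A(2) Z_edom)
    ultimately have 1: "q + q \<le> (S + A) * d + 1" and 2: "hr z \<le> hr z0 + S * d"
      using q unfolding distrib_right by linarith+
    have "d\<^sup>2 = lam * (q + q)" using lam by (simp add: q_def)
    also have "\<dots> \<le> lam * ((S + A) * d + 1)" using 1 lam by (intro mult_left_mono) auto
    finally have "d\<^sup>2 \<le> (lam * (S + A)) * d + lam" by (simp add: algebra_simps)
    from square_le_of_quadratic[OF this]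
    have "d\<^sup>2 \<le> lam\<^sup>2 * (S + A)\<^sup>2 + 2 * lam" by (simp add: power_mult_distrib)
    moreover have "\<bar>hr z - hr z0\<bar> \<le> 1 + (S + A) * d"
    proof -
      have "0 \<le> S * d" "0 \<le> A * d" using S A q by auto
      then show ?thesis using lo 2 unfolding distrib_right by linarith
    qed
    ultimately show ?thesis unfolding S_def d_def z_def by blast
  qed
  show ?thesis using that[of A] A(1) main by blast
qed

lemma phi_average_le:
  assumes f: "proper_closed_convex f" and dom: "edom h \<subseteq> edom f"
  shows "phi f h (smax_za F s h lam I B z0 w (Suc j))
    \<le> ereal (damped_max \<beta> {} (\<lambda>i. real_of_ereal (f (Z w (Suc i))) + hr (Z w (Suc i))) j)"
proof -
  let ?p = "\<lambda>x. real_of_ereal (f x) + hr x" and ?za = "smax_za F s h lam I B z0 w"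
  have "?za (Suc j) \<in> edom h \<and> ?p (?za (Suc j)) \<le> damped_max \<beta> {} (\<lambda>i. ?p (Z w (Suc i))) j"
  proof (induction j)
    case 0
    then show ?case using Z_edom[of w 1] by (simp del: smax_z.simps)
  next
    case (Suc j)
    let ?x = "Z w (Suc (Suc j))" and ?y = "?za (Suc j)"
    have za: "?za (Suc (Suc j)) = (1 - \<beta>) *\<^sub>R ?x + \<beta> *\<^sub>R ?y" by (simp del: smax_z.simps)
    have x: "?x \<in> edom h" and y: "?y \<in> edom h" using Suc by (auto intro: Z_edom simp del: smax_z.simps)
    note H = edom_convex_combination[OF h x y, of \<beta>]
      and G = edom_convex_combination[OF f, of ?x ?y \<beta>]
    have "?p (?za (Suc (Suc j))) \<le> (1 - \<beta>) * ?p ?x + \<beta> * ?p ?y"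
      unfolding za distrib_left using H G x y dom beta by (smt (verit) subsetD)
    also have "\<dots> \<le> (1 - \<beta>) * ?p ?x + \<beta> * damped_max \<beta> {} (\<lambda>i. ?p (Z w (Suc i))) j"
      using Suc beta by (intro add_left_mono mult_left_mono) auto
    finally show ?case using H beta unfolding za by simp
  qed
  moreover from this have "phi f h (?za (Suc j)) = ereal (?p (?za (Suc j)))"
    using ereal_real_on_edom[OF f, of "?za (Suc j)"] ereal_real_on_edom[OF h, of "?za (Suc j)"] dom
    by (auto simp: phi_def simp flip: plus_ereal.simps(1))
  ultimately show ?thesis by simp
qed

end

section \<open>Expectations of extended-real variables\<close>

lemma eexpectation_eq_integral:
  assumes "integrable N x" and "AE \<omega> in N. X \<omega> = ereal (x \<omega>)"
  shows "eexpectation N X = ereal (\<integral>\<omega>. x \<omega> \<partial>N)"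
proof -
  have "(\<integral>\<^sup>+\<omega>. e2ennreal (X \<omega>) \<partial>N) = (\<integral>\<^sup>+\<omega>. ennreal (x \<omega>) \<partial>N)"
    "(\<integral>\<^sup>+\<omega>. e2ennreal (- X \<omega>) \<partial>N) = (\<integral>\<^sup>+\<omega>. ennreal (- x \<omega>) \<partial>N)"
    using assms(2) by (auto intro!: nn_integral_cong_AE)
  moreover have "(\<integral>\<^sup>+\<omega>. ennreal (x \<omega>) \<partial>N) \<noteq> \<infinity>" "(\<integral>\<^sup>+\<omega>. ennreal (- x \<omega>) \<partial>N) \<noteq> \<infinity>"
    using assms(1) by (auto simp: real_integrable_def)
  then obtain a b where ab: "(\<integral>\<^sup>+\<omega>. ennreal (x \<omega>) \<partial>N) = ennreal a" "0 \<le> a"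
    "(\<integral>\<^sup>+\<omega>. ennreal (- x \<omega>) \<partial>N) = ennreal b" "0 \<le> b"
    by (metis ennreal_cases infinity_ennreal_def)
  moreover have "(\<integral>\<omega>. x \<omega> \<partial>N) = a - b"
    using ab by (simp add: real_lebesgue_integral_def[OF assms(1)])
  ultimately show ?thesis by (simp add: eexpectation_def)
qed

text \<open>
  The nonnegative integral is monotone on arbitrary functions, so that \<open>\<phi>(z\<^sub>I\<^sup>a)\<close> can be compared
  directly with an integrable upper bound.
\<close>

lemma eexpectation_mono:
  assumes "\<And>\<omega>. X \<omega> \<le> Y \<omega>"
  shows "eexpectation N X \<le> eexpectation N Y"
proof -
  have "(\<integral>\<^sup>+\<omega>. e2ennreal (X \<omega>) \<partial>N) \<le> (\<integral>\<^sup>+\<omega>. e2ennreal (Y \<omega>) \<partial>N)"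
    "(\<integral>\<^sup>+\<omega>. e2ennreal (- Y \<omega>) \<partial>N) \<le> (\<integral>\<^sup>+\<omega>. e2ennreal (- X \<omega>) \<partial>N)"
    using assms by (auto intro!: nn_integral_mono e2ennreal_mono)
  then show ?thesis unfolding eexpectation_def
    by (intro ereal_minus_mono) (simp_all add: less_eq_ennreal.rep_eq)
qed

lemma eexpectation_nonneg:
  assumes "\<And>\<omega>. 0 \<le> x \<omega>"
  shows "eexpectation N (\<lambda>\<omega>. ereal (x \<omega>)) = enn2ereal (\<integral>\<^sup>+\<omega>. ennreal (x \<omega>) \<partial>N)"
  using assms by (simp add: eexpectation_def ennreal_neg zero_ennreal.rep_eq)

lemma esqrt_eexpectation_square_finite:
  assumes "esqrt (eexpectation N (\<lambda>\<omega>. ereal ((x \<omega>)\<^sup>2))) \<noteq> \<infinity>" and "x \<in> borel_measurable N"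
  shows "integrable N (\<lambda>\<omega>. (x \<omega>)\<^sup>2)"
    and "esqrt (eexpectation N (\<lambda>\<omega>. ereal ((x \<omega>)\<^sup>2))) = ereal (sqrt (\<integral>\<omega>. (x \<omega>)\<^sup>2 \<partial>N))"
proof -
  note [measurable] = assms(2)
  have "(\<integral>\<^sup>+\<omega>. ennreal ((x \<omega>)\<^sup>2) \<partial>N) \<noteq> top"
    using assms(1) by (auto simp: eexpectation_nonneg esqrt_def split: if_splits)
  then show int: "integrable N (\<lambda>\<omega>. (x \<omega>)\<^sup>2)"
    by (intro integrableI_nonneg) (auto simp: top.not_eq_extremum)
  have "eexpectation N (\<lambda>\<omega>. ereal ((x \<omega>)\<^sup>2)) = ereal (\<integral>\<omega>. (x \<omega>)\<^sup>2 \<partial>N)"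
    by (rule eexpectation_eq_integral[OF int]) simp
  then show "esqrt (eexpectation N (\<lambda>\<omega>. ereal ((x \<omega>)\<^sup>2))) = ereal (sqrt (\<integral>\<omega>. (x \<omega>)\<^sup>2 \<partial>N))"
    by (simp add: esqrt_def)
qed

section \<open>Noise in the aggregated models\<close>

text \<open>
  Beyond the last index of \<open>B\<close> the recursion is linear, so centred entries contribute nothing and
  the mean decays geometrically.
\<close>

lemma (in prob_space) damped_max_centred_tail:
  assumes int: "\<And>i. i \<le> n \<Longrightarrow> integrable M (\<lambda>\<omega>. y \<omega> i)"
    and mean: "\<And>i. i \<le> n \<Longrightarrow> expectation (\<lambda>\<omega>. y \<omega> i) = 0"
    and B: "B \<subseteq> {..Suc k}"
  shows "k + m \<le> n \<Longrightarrow> expectation (\<lambda>\<omega>. damped_max \<beta> B (y \<omega>) (k + m))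
    = \<beta> ^ m * expectation (\<lambda>\<omega>. damped_max \<beta> B (y \<omega>) k)"
proof (induction m)
  case (Suc m)
  have "Suc (Suc (k + m)) \<notin> B" using B by auto
  moreover have "integrable M (\<lambda>\<omega>. damped_max \<beta> B (y \<omega>) (k + m))"
    using Suc.prems by (intro damped_max_integrable int) auto
  moreover have "integrable M (\<lambda>\<omega>. y \<omega> (Suc (k + m)))" "expectation (\<lambda>\<omega>. y \<omega> (Suc (k + m))) = 0"
    using Suc.prems int mean by auto
  ultimately show ?case using Suc by simp
qed simp

text \<open>
  The positive part is dominated by the recursion with \<open>max a p\<close> in place of \<open>a\<close>; by convexity of
  the square and \<open>(max a p)\<^sup>2 \<le> a\<^sup>2 + p\<^sup>2\<close>, a step in \<open>B\<close> raises the second moment by at most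
  one variance, and a step outside \<open>B\<close> averages it with one variance, hence does not raise the
  bound once a variance has been counted. That is the role of \<open>1 \<in> B\<close>: it accounts for the
  initial entry. The dominating variable \<open>Q\<close> also supplies integrability.
\<close>

lemma (in prob_space) damped_max_second_moment:
  assumes \<beta>: "0 \<le> \<beta>" "\<beta> \<le> 1" and v: "0 \<le> v"
    and int2: "\<And>i. i \<le> n \<Longrightarrow> integrable M (\<lambda>\<omega>. (y \<omega> i)\<^sup>2)"
    and mom2: "\<And>i. i \<le> n \<Longrightarrow> expectation (\<lambda>\<omega>. (y \<omega> i)\<^sup>2) \<le> v"
    and B: "1 \<in> B"
  shows "j \<le> n \<Longrightarrow> \<exists>Q. integrable M Q \<and> (\<forall>\<omega>. (max (damped_max \<beta> B (y \<omega>) j) 0)\<^sup>2 \<le> Q \<omega>)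
     \<and> expectation Q \<le> real (card (B \<inter> {1..Suc j})) * v"
proof (induction j)
  case 0
  have "B \<inter> {1..Suc 0} = {1}" using B by auto
  moreover have "(max a 0)\<^sup>2 \<le> a\<^sup>2" for a :: real by (auto simp: max_def)
  ultimately show ?case using int2[OF 0] mom2[OF 0] by (intro exI[of _ "\<lambda>\<omega>. (y \<omega> 0)\<^sup>2"]) auto
next
  case (Suc j)
  then obtain Q where Q: "integrable M Q" "\<And>\<omega>. (max (damped_max \<beta> B (y \<omega>) j) 0)\<^sup>2 \<le> Q \<omega>"
    "expectation Q \<le> real (card (B \<inter> {1..Suc j})) * v" by auto
  define b where "b = card (B \<inter> {1..Suc j})"
  have b: "1 \<le> b"
  proof -
    have "B \<inter> {1..Suc j} \<noteq> {}" using B by auto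
    then show ?thesis by (simp add: b_def Suc_le_eq card_gt_0_iff)
  qed
  have nonneg: "0 \<le> expectation Q"
    by (intro integral_nonneg_AE AE_I2 order_trans[OF zero_le_power2 Q(2)])
  let ?c = "if Suc (Suc j) \<in> B then 1 else 1 - \<beta>"
  define Q' where "Q' \<omega> = ?c * (y \<omega> (Suc j))\<^sup>2 + \<beta> * Q \<omega>" for \<omega>
  have sq: "((1 - \<beta>) * p + \<beta> * q)\<^sup>2 \<le> (1 - \<beta>) * p\<^sup>2 + \<beta> * q\<^sup>2" for p q :: real
  proof -
    have "0 \<le> (1 - \<beta>) * \<beta> * (p - q)\<^sup>2" using \<beta> by simp
    then show ?thesis by (simp add: power2_eq_square algebra_simps)
  qed
  have bound: "(max (damped_max \<beta> B (y \<omega>) (Suc j)) 0)\<^sup>2 \<le> Q' \<omega>" for \<omega>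
  proof -
    define p where "p = max (y \<omega> (Suc j)) 0"
    define a where "a = max (damped_max \<beta> B (y \<omega>) j) 0"
    define q where "q = (if Suc (Suc j) \<in> B then max a p else a)"
    have p: "0 \<le> p" "y \<omega> (Suc j) \<le> p" "p\<^sup>2 \<le> (y \<omega> (Suc j))\<^sup>2" by (auto simp: p_def max_def)
    have a: "0 \<le> a" "damped_max \<beta> B (y \<omega>) j \<le> a" "a\<^sup>2 \<le> Q \<omega>" using Q(2) by (auto simp: a_def)
    have q: "0 \<le> q" using a by (auto simp: q_def)
    have "(1 - \<beta>) * y \<omega> (Suc j) \<le> (1 - \<beta>) * p" using p \<beta> by (intro mult_left_mono) auto
    moreover have "\<beta> * (if Suc (Suc j) \<in> B then max (damped_max \<beta> B (y \<omega>) j) (y \<omega> (Suc j))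
        else damped_max \<beta> B (y \<omega>) j) \<le> \<beta> * q"
      using p a \<beta> by (intro mult_left_mono) (auto simp: q_def)
    moreover have "0 \<le> (1 - \<beta>) * p" "0 \<le> \<beta> * q" using p q \<beta> by auto
    ultimately have "max (damped_max \<beta> B (y \<omega>) (Suc j)) 0 \<le> (1 - \<beta>) * p + \<beta> * q" by simp
    then have "(max (damped_max \<beta> B (y \<omega>) (Suc j)) 0)\<^sup>2 \<le> ((1 - \<beta>) * p + \<beta> * q)\<^sup>2"
      by (intro power_mono) auto
    also have "\<dots> \<le> (1 - \<beta>) * p\<^sup>2 + \<beta> * q\<^sup>2" by (rule sq)
    also have "\<dots> \<le> ?c * p\<^sup>2 + \<beta> * a\<^sup>2"
    proof (cases "Suc (Suc j) \<in> B")
      case True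
      have "q\<^sup>2 \<le> a\<^sup>2 + p\<^sup>2" using True by (auto simp: q_def max_def)
      then have "\<beta> * q\<^sup>2 \<le> \<beta> * (a\<^sup>2 + p\<^sup>2)" using \<beta> by (intro mult_left_mono)
      then show ?thesis using True by (simp add: algebra_simps)
    qed (simp add: q_def)
    also have "\<dots> \<le> Q' \<omega>" unfolding Q'_def
      using p a \<beta> by (intro add_mono mult_left_mono) auto
    finally show ?thesis .
  qed
  have int: "integrable M Q'" unfolding Q'_def using Q(1) int2[OF Suc.prems] by auto
  have "expectation Q' = ?c * expectation (\<lambda>\<omega>. (y \<omega> (Suc j))\<^sup>2) + \<beta> * expectation Q"
    unfolding Q'_def using Q(1) int2[OF Suc.prems] by simp
  also have "\<dots> \<le> ?c * v + \<beta> * expectation Q"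
    using \<beta> mom2[OF Suc.prems] by (intro add_right_mono mult_left_mono) auto
  also have "\<dots> \<le> real (card (B \<inter> {1..Suc (Suc j)})) * v"
  proof (cases "Suc (Suc j) \<in> B")
    case True
    then have "B \<inter> {1..Suc (Suc j)} = insert (Suc (Suc j)) (B \<inter> {1..Suc j})" by auto
    then have "card (B \<inter> {1..Suc (Suc j)}) = Suc b" by (simp add: b_def)
    moreover have "\<beta> * expectation Q \<le> expectation Q" using nonneg \<beta> by (intro mult_left_le_one_le) auto
    ultimately show ?thesis using True Q(3) by (simp add: b_def algebra_simps)
  next
    case False
    then have "B \<inter> {1..Suc (Suc j)} = B \<inter> {1..Suc j}" by (auto simp: le_Suc_eq)
    moreover have "\<beta> * expectation Q \<le> \<beta> * (real b * v)" using Q(3) \<beta> by (intro mult_left_mono) (auto simp: b_def)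
    moreover have "(1 - \<beta>) * v \<le> (1 - \<beta>) * (real b * v)"
    proof -
      have "1 * v \<le> real b * v" using b v by (intro mult_right_mono) auto
      then show ?thesis using \<beta> by (intro mult_left_mono) auto
    qed
    ultimately show ?thesis using False by (simp add: b_def algebra_simps)
  qed
  finally show ?case using int bound by blast
qed

text \<open>
  While maxima are taken, the mean is at most the root of the second moment of the positive part;
  afterwards it is damped by a factor \<open>\<beta>\<close> per step.
\<close>

lemma (in prob_space) damped_max_centred_bound:
  assumes \<beta>: "0 \<le> \<beta>" "\<beta> \<le> 1" and v: "0 \<le> v"
    and int: "\<And>i. i \<le> n \<Longrightarrow> integrable M (\<lambda>\<omega>. y \<omega> i)"
    and mean: "\<And>i. i \<le> n \<Longrightarrow> expectation (\<lambda>\<omega>. y \<omega> i) = 0"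
    and int2: "\<And>i. i \<le> n \<Longrightarrow> integrable M (\<lambda>\<omega>. (y \<omega> i)\<^sup>2)"
    and mom2: "\<And>i. i \<le> n \<Longrightarrow> expectation (\<lambda>\<omega>. (y \<omega> i)\<^sup>2) \<le> v"
    and B: "1 \<in> B" "B \<subseteq> {1..Suc k}" and k: "k \<le> n"
  shows "expectation (\<lambda>\<omega>. damped_max \<beta> B (y \<omega>) n) \<le> \<beta> ^ (n - k) * sqrt (real (card B) * v)"
proof -
  let ?Y = "\<lambda>\<omega>. damped_max \<beta> B (y \<omega>) k"
  obtain Q where Q: "integrable M Q" "\<And>\<omega>. (max (?Y \<omega>) 0)\<^sup>2 \<le> Q \<omega>"
    "expectation Q \<le> real (card (B \<inter> {1..Suc k})) * v"
    using damped_max_second_moment[where y = y and B = B, OF \<beta> v int2 mom2 B(1) k] by blast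
  have cb: "B \<inter> {1..Suc k} = B" using B by auto
  have Y: "integrable M ?Y" using k by (intro damped_max_integrable int) auto
  define X where "X \<omega> = max (?Y \<omega>) 0" for \<omega>
  have X: "integrable M X" unfolding X_def using Y by (intro integrable_max) auto
  then have [measurable]: "X \<in> borel_measurable M" by auto
  have X2: "integrable M (\<lambda>\<omega>. (X \<omega>)\<^sup>2)"
  proof (rule Bochner_Integration.integrable_bound[OF Q(1)])
    have "0 \<le> (X \<omega>)\<^sup>2" "(X \<omega>)\<^sup>2 \<le> Q \<omega>" for \<omega> using Q(2)[of \<omega>] by (simp_all add: X_def)
    then have "norm ((X \<omega>)\<^sup>2) \<le> norm (Q \<omega>)" for \<omega> by (metis abs_ge_self abs_of_nonneg order_trans real_norm_def)
    then show "AE \<omega> in M. norm ((X \<omega>)\<^sup>2) \<le> norm (Q \<omega>)" by simp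
  qed measurable
  have "(expectation X)\<^sup>2 \<le> expectation (\<lambda>\<omega>. (X \<omega>)\<^sup>2)"
    using variance_positive[of X] variance_eq[OF X X2] by simp
  also have "\<dots> \<le> expectation Q" using X2 Q by (intro integral_mono) (auto simp: X_def)
  also have "\<dots> \<le> real (card B) * v" using Q(3) cb by simp
  finally have "expectation X \<le> sqrt (real (card B) * v)" by (rule real_le_rsqrt)
  moreover have "expectation ?Y \<le> expectation X" using X Y by (intro integral_mono) (auto simp: X_def)
  ultimately have "\<beta> ^ (n - k) * expectation ?Y \<le> \<beta> ^ (n - k) * sqrt (real (card B) * v)"
    using \<beta> by (intro mult_left_mono) auto
  moreover have "B \<subseteq> {..Suc k}" using B by auto
  from damped_max_centred_tail[where y = y and m = "n - k" and \<beta> = \<beta>, OF int mean this] k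
  have "expectation (\<lambda>\<omega>. damped_max \<beta> B (y \<omega>) n) = \<beta> ^ (n - k) * expectation ?Y" by simp
  ultimately show ?thesis by simp
qed

section \<open>Independence and moments\<close>

text \<open>
  The samples now are random. The condition on the subgradients is kept as a bound on a
  nonnegative integral, the form in which it passes through Fubini's theorem.
\<close>

locale smax1c_random = smax1c F s h lam I B z0 + P: prob_space P + \<Omega>: prob_space \<Omega>
  for F :: "'a::euclidean_space \<Rightarrow> 'b \<Rightarrow> real"
    and s :: "'a \<Rightarrow> 'b \<Rightarrow> 'a"
    and h :: "'a \<Rightarrow> ereal"
    and lam :: real
    and I :: nat
    and B :: "nat set"
    and z0 :: 'a
    and P :: "'b measure"
    and \<Omega> :: "'w measure" +
  fixes f :: "'a \<Rightarrow> ereal"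
    and \<xi> :: "nat \<Rightarrow> 'w \<Rightarrow> 'b"
    and M :: real
  assumes F_meas: "(\<lambda>(x, v). F x v) \<in> borel_measurable (restrict_space borel (edom h) \<Otimes>\<^sub>M P)"
    and s_meas: "(\<lambda>(x, v). s x v) \<in> borel_measurable (restrict_space borel (edom h) \<Otimes>\<^sub>M P)"
    and f_mean: "\<And>x. x \<in> edom h \<Longrightarrow> integrable P (F x) \<and> f x = ereal (\<integral>v. F x v \<partial>P)"
    and s_subgrad: "AE v in P. \<forall>x\<in>edom h. s x v \<in> subdifferential (edom h) (\<lambda>x. F x v) x"
    and s_moment: "\<And>x. x \<in> edom h \<Longrightarrow> (\<integral>\<^sup>+v. ennreal ((norm (s x v))\<^sup>2) \<partial>P) \<le> ennreal (M\<^sup>2)"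
    and indep: "\<Omega>.indep_vars (\<lambda>_. P) \<xi> {0..I}"
    and law: "\<And>j. j \<le> I \<Longrightarrow> distr \<Omega> P (\<xi> j) = P"
begin

abbreviation "W \<omega> \<equiv> \<lambda>j. \<xi> j \<omega>"
abbreviation "S \<equiv> restrict_space borel (edom h)"
abbreviation "fr x \<equiv> real_of_ereal (f x)"

lemma xi_measurable: "j \<le> I \<Longrightarrow> \<xi> j \<in> measurable \<Omega> P"
  using indep by (auto simp: \<Omega>.indep_vars_def2)

lemma Z_random: "k \<le> Suc I \<Longrightarrow> (\<lambda>\<omega>. Z (W \<omega>) k) \<in> measurable \<Omega> S"
  by (intro Z_measurable[OF F_meas s_meas] xi_measurable) auto

lemma Z_borel: "k \<le> Suc I \<Longrightarrow> (\<lambda>\<omega>. Z (W \<omega>) k) \<in> borel_measurable \<Omega>"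
  using Z_random[of k] by (simp add: measurable_restrict_space2_iff)

lemma Z_xi_measurable:
  assumes "k \<le> j" "j \<le> I"
  shows "(\<lambda>\<omega>. (Z (W \<omega>) k, \<xi> j \<omega>)) \<in> measurable \<Omega> (S \<Otimes>\<^sub>M P)"
  using assms by (intro measurable_Pair Z_random xi_measurable) auto

text \<open>
  The iterate \<open>z\<^sub>k\<close> is a function of the samples before \<open>k\<close>, so for \<open>j \<ge> k\<close> it is independent of
  \<open>\<xi>\<^sub>j\<close> and the pair has a product law, the same for every such \<open>j\<close>. All expectations below reduce
  to this fact. The proof pushes the joint law of the two blocks of samples forward.
\<close>

lemma Z_xi_law:
  assumes kj: "k \<le> j" "j \<le> I"
  shows "distr \<Omega> (S \<Otimes>\<^sub>M P) (\<lambda>\<omega>. (Z (W \<omega>) k, \<xi> j \<omega>)) = distr \<Omega> S (\<lambda>\<omega>. Z (W \<omega>) k) \<Otimes>\<^sub>M P"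
proof -
  define A where "A = PiM {..<j} (\<lambda>_. P)"
  define C where "C = PiM {j} (\<lambda>_. P)"
  define X where "X \<omega> = restrict (W \<omega>) {..<j}" for \<omega>
  define Y where "Y \<omega> = restrict (W \<omega>) {j}" for \<omega>
  have "\<Omega>.indep_var A X C Y" unfolding A_def C_def X_def Y_def
    using kj by (intro \<Omega>.indep_var_restrict[OF indep]) auto
  then have X: "X \<in> measurable \<Omega> A" and Y: "Y \<in> measurable \<Omega> C"
    and XY: "distr \<Omega> A X \<Otimes>\<^sub>M distr \<Omega> C Y = distr \<Omega> (A \<Otimes>\<^sub>M C) (\<lambda>\<omega>. (X \<omega>, Y \<omega>))"
    unfolding \<Omega>.indep_var_distribution_eq by auto
  have Zm: "(\<lambda>w. Z w k) \<in> measurable A S"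
    unfolding A_def using kj by (intro Z_measurable[OF F_meas s_meas] measurable_component_singleton) auto
  have pm: "(\<lambda>w. w j) \<in> measurable C P"
    unfolding C_def by (intro measurable_component_singleton) auto
  have ZX: "Z (X \<omega>) k = Z (W \<omega>) k" for \<omega>
    using kj by (intro Z_cong) (simp add: X_def)
  have Yj: "Y \<omega> j = \<xi> j \<omega>" for \<omega> by (simp add: Y_def)
  have dZ: "distr (distr \<Omega> A X) S (\<lambda>w. Z w k) = distr \<Omega> S (\<lambda>\<omega>. Z (W \<omega>) k)"
    by (subst distr_distr[OF Zm X]) (simp add: comp_def ZX)
  have dP: "distr (distr \<Omega> C Y) P (\<lambda>w. w j) = P"
    by (subst distr_distr[OF pm Y]) (simp add: comp_def Yj law kj)
  have Zm': "(\<lambda>w. Z w k) \<in> measurable (distr \<Omega> A X) S" and pm': "(\<lambda>w. w j) \<in> measurable (distr \<Omega> C Y) P"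
    using Zm pm by simp_all
  have "sigma_finite_measure (distr (distr \<Omega> C Y) P (\<lambda>w. w j))"
    unfolding dP by (rule P.sigma_finite_measure_axioms)
  from pair_measure_distr[OF Zm' pm' this]
  have "distr \<Omega> S (\<lambda>\<omega>. Z (W \<omega>) k) \<Otimes>\<^sub>M P
      = distr (distr \<Omega> (A \<Otimes>\<^sub>M C) (\<lambda>\<omega>. (X \<omega>, Y \<omega>))) (S \<Otimes>\<^sub>M P) (\<lambda>(w, w'). (Z w k, w' j))"
    unfolding dZ dP XY .
  also have "\<dots> = distr \<Omega> (S \<Otimes>\<^sub>M P) ((\<lambda>(w, w'). (Z w k, w' j)) \<circ> (\<lambda>\<omega>. (X \<omega>, Y \<omega>)))"
  proof (rule distr_distr)
    show "(\<lambda>(w, w'). (Z w k, w' j)) \<in> measurable (A \<Otimes>\<^sub>M C) (S \<Otimes>\<^sub>M P)"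
      unfolding case_prod_beta
      by (intro measurable_Pair measurable_compose[OF measurable_fst Zm] measurable_compose[OF measurable_snd pm])
    show "(\<lambda>\<omega>. (X \<omega>, Y \<omega>)) \<in> measurable \<Omega> (A \<Otimes>\<^sub>M C)" using X Y by (rule measurable_Pair)
  qed
  also have "(\<lambda>(w, w'). (Z w k, w' j)) \<circ> (\<lambda>\<omega>. (X \<omega>, Y \<omega>)) = (\<lambda>\<omega>. (Z (W \<omega>) k, \<xi> j \<omega>))"
    by (simp add: fun_eq_iff ZX Yj)
  finally show ?thesis by simp
qed

lemma F_random: "k \<le> j \<Longrightarrow> j \<le> I \<Longrightarrow> (\<lambda>\<omega>. F (Z (W \<omega>) k) (\<xi> j \<omega>)) \<in> borel_measurable \<Omega>"
  using measurable_compose[OF Z_xi_measurable F_meas] by simp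

lemma s_random: "k \<le> j \<Longrightarrow> j \<le> I \<Longrightarrow> (\<lambda>\<omega>. s (Z (W \<omega>) k) (\<xi> j \<omega>)) \<in> borel_measurable \<Omega>"
  using measurable_compose[OF Z_xi_measurable s_meas] by simp

text \<open>
  The uniform second-moment bound at deterministic points carries over to the random point \<open>z\<^sub>k\<close>
  by integrating over the fresh sample first.
\<close>

lemma s_square_integrable:
  assumes kj: "k \<le> j" "j \<le> I"
  shows "integrable \<Omega> (\<lambda>\<omega>. (norm (s (Z (W \<omega>) k) (\<xi> j \<omega>)))\<^sup>2)"
    and "\<Omega>.expectation (\<lambda>\<omega>. (norm (s (Z (W \<omega>) k) (\<xi> j \<omega>)))\<^sup>2) \<le> M\<^sup>2"
proof -
  define g where "g = (\<lambda>(x, v). ennreal ((norm (s x v))\<^sup>2))"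
  have g: "g \<in> borel_measurable (S \<Otimes>\<^sub>M P)"
    using measurable_compose[OF s_meas, of "\<lambda>x. ennreal ((norm x)\<^sup>2)"] by (simp add: g_def case_prod_beta)
  have "sets (distr \<Omega> S (\<lambda>\<omega>. Z (W \<omega>) k) \<Otimes>\<^sub>M P) = sets (S \<Otimes>\<^sub>M P)"
    by (intro sets_pair_measure_cong) simp_all
  then have g': "g \<in> borel_measurable (distr \<Omega> S (\<lambda>\<omega>. Z (W \<omega>) k) \<Otimes>\<^sub>M P)"
    using g measurable_cong_sets[OF _ refl] by blast
  have "(\<integral>\<^sup>+\<omega>. g (Z (W \<omega>) k, \<xi> j \<omega>) \<partial>\<Omega>)
      = integral\<^sup>N (distr \<Omega> (S \<Otimes>\<^sub>M P) (\<lambda>\<omega>. (Z (W \<omega>) k, \<xi> j \<omega>))) g"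
    using g by (intro nn_integral_distr[symmetric] Z_xi_measurable kj) simp
  also have "\<dots> = integral\<^sup>N (distr \<Omega> S (\<lambda>\<omega>. Z (W \<omega>) k) \<Otimes>\<^sub>M P) g" by (simp add: Z_xi_law[OF kj])
  also have "\<dots> = (\<integral>\<^sup>+x. \<integral>\<^sup>+v. g (x, v) \<partial>P \<partial>distr \<Omega> S (\<lambda>\<omega>. Z (W \<omega>) k))"
    by (rule P.nn_integral_fst[OF g', symmetric])
  also have "\<dots> \<le> (\<integral>\<^sup>+x. ennreal (M\<^sup>2) \<partial>distr \<Omega> S (\<lambda>\<omega>. Z (W \<omega>) k))"
    by (intro nn_integral_mono) (auto simp: g_def space_restrict_space intro: s_moment)
  also have "\<dots> = ennreal (M\<^sup>2)"
  proof -
    interpret N: prob_space "distr \<Omega> S (\<lambda>\<omega>. Z (W \<omega>) k)"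
      using kj by (intro \<Omega>.prob_space_distr Z_random) auto
    show ?thesis using N.emeasure_space_1 by simp
  qed
  finally have le: "(\<integral>\<^sup>+\<omega>. ennreal ((norm (s (Z (W \<omega>) k) (\<xi> j \<omega>)))\<^sup>2) \<partial>\<Omega>) \<le> ennreal (M\<^sup>2)"
    by (simp add: g_def)
  note [measurable] = s_random[OF kj]
  show "integrable \<Omega> (\<lambda>\<omega>. (norm (s (Z (W \<omega>) k) (\<xi> j \<omega>)))\<^sup>2)"
    using le by (intro integrableI_nonneg) (auto intro: le_less_trans)
  show "\<Omega>.expectation (\<lambda>\<omega>. (norm (s (Z (W \<omega>) k) (\<xi> j \<omega>)))\<^sup>2) \<le> M\<^sup>2"
    using le by (intro integral_real_bounded) auto
qed

lemma AE_samples_ok: "AE \<omega> in \<Omega>. samples_ok (W \<omega>)"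
proof -
  have "AE \<omega> in \<Omega>. j \<le> I \<longrightarrow> (\<forall>x\<in>edom h. s x (\<xi> j \<omega>) \<in> subdifferential (edom h) (\<lambda>x. F x (\<xi> j \<omega>)) x)" for j
  proof (cases "j \<le> I")
    case True
    have "AE v in distr \<Omega> P (\<xi> j). \<forall>x\<in>edom h. s x v \<in> subdifferential (edom h) (\<lambda>x. F x v) x"
      unfolding law[OF True] by (rule s_subgrad)
    from AE_distrD[OF xi_measurable[OF True] this] show ?thesis by simp
  qed simp
  then show ?thesis unfolding samples_ok_def AE_all_countable by blast
qed

text \<open>
  Square integrability of the earlier subgradients passes to the iterates through the pathwise
  bounds, whose right-hand sides are quadratic in the sum \<open>T\<close> of the subgradient norms.
\<close>

lemma Z_square_integrable:
  assumes "k \<le> Suc I"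
  shows "integrable \<Omega> (\<lambda>\<omega>. (norm (Z (W \<omega>) k - z0))\<^sup>2)"
    and "integrable \<Omega> (\<lambda>\<omega>. hr (Z (W \<omega>) k))"
proof -
  obtain A where A: "A \<ge> 0"
    and d: "\<And>w j. (norm (Z w j - z0))\<^sup>2 \<le> lam\<^sup>2 * ((\<Sum>i<j. norm (sg w i)) + A)\<^sup>2 + 2 * lam"
    and hb: "\<And>w j. \<bar>hr (Z w j) - hr z0\<bar> \<le> 1 + ((\<Sum>i<j. norm (sg w i)) + A) * norm (Z w j - z0)"
    using Z_bounds by blast
  define T where "T \<omega> = (\<Sum>i<k. norm (sg (W \<omega>) i)) + A" for \<omega>
  have sr: "(\<lambda>\<omega>. sg (W \<omega>) i) \<in> borel_measurable \<Omega>" if "i < k" for i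
    using that assms by (intro s_random) auto
  have Tm[measurable]: "T \<in> borel_measurable \<Omega>"
    unfolding T_def by (intro borel_measurable_add borel_measurable_sum measurable_compose[OF sr borel_measurable_norm]) auto
  have Tint: "integrable \<Omega> (\<lambda>\<omega>. (T \<omega>)\<^sup>2)"
  proof (rule Bochner_Integration.integrable_bound)
    show "integrable \<Omega> (\<lambda>\<omega>. 2 * ((\<Sum>i<k. (norm (sg (W \<omega>) i))\<^sup>2) * real k) + 2 * A\<^sup>2)"
      using assms by (intro Bochner_Integration.integrable_add Bochner_Integration.integrable_sum
          integrable_mult_right integrable_mult_left s_square_integrable) auto
    show "AE \<omega> in \<Omega>. norm ((T \<omega>)\<^sup>2) \<le> norm (2 * ((\<Sum>i<k. (norm (sg (W \<omega>) i))\<^sup>2) * real k) + 2 * A\<^sup>2)"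
    proof (rule AE_I2)
      fix \<omega>
      have "(T \<omega>)\<^sup>2 \<le> 2 * (\<Sum>i<k. norm (sg (W \<omega>) i))\<^sup>2 + 2 * A\<^sup>2"
        unfolding T_def using sum_squares_ge_zero[of "(\<Sum>i<k. norm (sg (W \<omega>) i)) - A" 0]
        by (simp add: power2_eq_square algebra_simps)
      moreover have "(\<Sum>i<k. norm (sg (W \<omega>) i))\<^sup>2 \<le> (\<Sum>i<k. (norm (sg (W \<omega>) i))\<^sup>2) * real k"
        using sum_squared_le_sum_of_squares[of "\<lambda>i. norm (sg (W \<omega>) i)" "{..<k}"] by simp
      moreover have "0 \<le> (\<Sum>i<k. (norm (sg (W \<omega>) i))\<^sup>2) * real k" by (intro mult_nonneg_nonneg sum_nonneg) auto
      ultimately show "norm ((T \<omega>)\<^sup>2) \<le> norm (2 * ((\<Sum>i<k. (norm (sg (W \<omega>) i))\<^sup>2) * real k) + 2 * A\<^sup>2)"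
        by simp
    qed
  qed simp
  note [measurable] = Z_borel[OF assms]
  show int: "integrable \<Omega> (\<lambda>\<omega>. (norm (Z (W \<omega>) k - z0))\<^sup>2)"
  proof (rule Bochner_Integration.integrable_bound)
    show "integrable \<Omega> (\<lambda>\<omega>. lam\<^sup>2 * (T \<omega>)\<^sup>2 + 2 * lam)" using Tint by simp
    show "AE \<omega> in \<Omega>. norm ((norm (Z (W \<omega>) k - z0))\<^sup>2) \<le> norm (lam\<^sup>2 * (T \<omega>)\<^sup>2 + 2 * lam)"
      using d[of "W _" k] lam by (intro AE_I2) (simp add: T_def)
  qed measurable
  have hm: "(\<lambda>\<omega>. hr (Z (W \<omega>) k)) \<in> borel_measurable \<Omega>"
    using proper_closed_convex_measurable[OF h] by measurable
  have hint: "integrable \<Omega> (\<lambda>\<omega>. hr (Z (W \<omega>) k) - hr z0)"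
  proof (rule Bochner_Integration.integrable_bound)
    show "integrable \<Omega> (\<lambda>\<omega>. 1 + ((T \<omega>)\<^sup>2 + (norm (Z (W \<omega>) k - z0))\<^sup>2))" using Tint int by simp
    show "AE \<omega> in \<Omega>. norm (hr (Z (W \<omega>) k) - hr z0) \<le> norm (1 + ((T \<omega>)\<^sup>2 + (norm (Z (W \<omega>) k - z0))\<^sup>2))"
    proof (rule AE_I2)
      fix \<omega>
      have "T \<omega> * norm (Z (W \<omega>) k - z0) \<le> (T \<omega>)\<^sup>2 + (norm (Z (W \<omega>) k - z0))\<^sup>2"
        using young_product[of 1 "T \<omega>" "norm (Z (W \<omega>) k - z0)"] zero_le_power2[of "norm (Z (W \<omega>) k - z0)"] by linarith
      then show "norm (hr (Z (W \<omega>) k) - hr z0) \<le> norm (1 + ((T \<omega>)\<^sup>2 + (norm (Z (W \<omega>) k - z0))\<^sup>2))"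
        using hb[of "W \<omega>" k] by (simp add: T_def)
    qed
  qed (use hm in measurable)
  have "integrable \<Omega> (\<lambda>\<omega>. (hr (Z (W \<omega>) k) - hr z0) + hr z0)"
    using hint by (intro Bochner_Integration.integrable_add) auto
  then show "integrable \<Omega> (\<lambda>\<omega>. hr (Z (W \<omega>) k))" by simp
qed

lemma F_at_sample:
  assumes x: "x \<in> edom h" and j: "j \<le> I"
  shows "integrable \<Omega> (\<lambda>\<omega>. F x (\<xi> j \<omega>))" and "\<Omega>.expectation (\<lambda>\<omega>. F x (\<xi> j \<omega>)) = fr x"
proof -
  have F: "integrable P (F x)" "fr x = (\<integral>v. F x v \<partial>P)" using f_mean[OF x] by auto
  show "integrable \<Omega> (\<lambda>\<omega>. F x (\<xi> j \<omega>))"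
    by (rule integrable_distr[OF xi_measurable[OF j]]) (use F(1) law[OF j] in simp)
  have "(\<integral>v. F x v \<partial>distr \<Omega> P (\<xi> j)) = \<Omega>.expectation (\<lambda>\<omega>. F x (\<xi> j \<omega>))"
    using F(1) by (intro integral_distr xi_measurable j) auto
  then show "\<Omega>.expectation (\<lambda>\<omega>. F x (\<xi> j \<omega>)) = fr x" using F(2) law[OF j] by simp
qed

text \<open>
  The two subgradient inequalities between \<open>z\<^sub>k\<close> and \<open>z0\<close> bound the difference of the \<open>F\<close> values
  by products of square-integrable variables.
\<close>

lemma F_integrable:
  assumes kj: "k \<le> j" "j \<le> I"
  shows "integrable \<Omega> (\<lambda>\<omega>. F (Z (W \<omega>) k) (\<xi> j \<omega>))"
proof -
  let ?z = "\<lambda>\<omega>. Z (W \<omega>) k"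
  have s0: "integrable \<Omega> (\<lambda>\<omega>. (norm (s z0 (\<xi> j \<omega>)))\<^sup>2)" using s_square_integrable(1)[of 0 j] kj by simp
  have F0: "integrable \<Omega> (\<lambda>\<omega>. F z0 (\<xi> j \<omega>))" by (rule F_at_sample[OF z0 kj(2)])
  have int: "integrable \<Omega> (\<lambda>\<omega>. (norm (s (?z \<omega>) (\<xi> j \<omega>)))\<^sup>2 + (norm (s z0 (\<xi> j \<omega>)))\<^sup>2 + (norm (?z \<omega> - z0))\<^sup>2)"
    using s_square_integrable(1)[OF kj] s0 Z_square_integrable(1)[of k] kj by simp
  have "integrable \<Omega> (\<lambda>\<omega>. F (?z \<omega>) (\<xi> j \<omega>) - F z0 (\<xi> j \<omega>))"
  proof (rule Bochner_Integration.integrable_bound[OF int])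
    show "(\<lambda>\<omega>. F (?z \<omega>) (\<xi> j \<omega>) - F z0 (\<xi> j \<omega>)) \<in> borel_measurable \<Omega>"
      using F_random[OF kj] F0 by (intro borel_measurable_diff) auto
    show "AE \<omega> in \<Omega>. norm (F (?z \<omega>) (\<xi> j \<omega>) - F z0 (\<xi> j \<omega>))
       \<le> norm ((norm (s (?z \<omega>) (\<xi> j \<omega>)))\<^sup>2 + (norm (s z0 (\<xi> j \<omega>)))\<^sup>2 + (norm (?z \<omega> - z0))\<^sup>2)"
      using AE_samples_ok
    proof eventually_elim
      case (elim \<omega>)
      define a b d where "a = norm (s (?z \<omega>) (\<xi> j \<omega>))" "b = norm (s z0 (\<xi> j \<omega>))" "d = norm (?z \<omega> - z0)"
      have "F (?z \<omega>) (\<xi> j \<omega>) + s (?z \<omega>) (\<xi> j \<omega>) \<bullet> (z0 - ?z \<omega>) \<le> F z0 (\<xi> j \<omega>)"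
        using samples_okD[OF elim kj(2) Z_edom z0] by simp
      moreover have "F z0 (\<xi> j \<omega>) + s z0 (\<xi> j \<omega>) \<bullet> (?z \<omega> - z0) \<le> F (?z \<omega>) (\<xi> j \<omega>)"
        using samples_okD[OF elim kj(2) z0 Z_edom] by simp
      moreover have "\<bar>s (?z \<omega>) (\<xi> j \<omega>) \<bullet> (z0 - ?z \<omega>)\<bar> \<le> a * d" "\<bar>s z0 (\<xi> j \<omega>) \<bullet> (?z \<omega> - z0)\<bar> \<le> b * d"
        unfolding a_b_d_def by (metis Cauchy_Schwarz_ineq2 norm_minus_commute) (rule Cauchy_Schwarz_ineq2)
      moreover have "a * d \<le> a\<^sup>2 + d\<^sup>2" "b * d \<le> b\<^sup>2 + d\<^sup>2"
        using young_product[of 1 a d] young_product[of 1 b d] zero_le_power2[of d] by linarith+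
      moreover have "0 \<le> a\<^sup>2" "0 \<le> b\<^sup>2" "0 \<le> d\<^sup>2" by auto
      ultimately have "\<bar>F (?z \<omega>) (\<xi> j \<omega>) - F z0 (\<xi> j \<omega>)\<bar> \<le> a\<^sup>2 + b\<^sup>2 + d\<^sup>2" by linarith
      then show ?case unfolding a_b_d_def by simp
    qed
  qed
  then have "integrable \<Omega> (\<lambda>\<omega>. (F (?z \<omega>) (\<xi> j \<omega>) - F z0 (\<xi> j \<omega>)) + F z0 (\<xi> j \<omega>))"
    using F0 by (rule Bochner_Integration.integrable_add)
  then show ?thesis by simp
qed

text \<open>
  Integrating over the fresh sample first turns \<open>F(z\<^sub>k, \<xi>\<^sub>j)\<close> into \<open>f(z\<^sub>k)\<close>. In particular the
  expectation does not depend on \<open>j \<ge> k\<close>, so the sampling differences in the step errors vanish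
  in the mean.
\<close>

lemma F_expectation:
  assumes kj: "k \<le> j" "j \<le> I"
  shows "integrable \<Omega> (\<lambda>\<omega>. fr (Z (W \<omega>) k))"
    and "\<Omega>.expectation (\<lambda>\<omega>. F (Z (W \<omega>) k) (\<xi> j \<omega>)) = \<Omega>.expectation (\<lambda>\<omega>. fr (Z (W \<omega>) k))"
proof -
  define N where "N = distr \<Omega> S (\<lambda>\<omega>. Z (W \<omega>) k)"
  define g where "g = (\<lambda>(x, v). F x v)"
  have Zr: "(\<lambda>\<omega>. Z (W \<omega>) k) \<in> measurable \<Omega> S" using kj by (intro Z_random) auto
  interpret N: prob_space N unfolding N_def by (rule \<Omega>.prob_space_distr[OF Zr])
  interpret NP: pair_sigma_finite N P ..
  have lawN: "distr \<Omega> (S \<Otimes>\<^sub>M P) (\<lambda>\<omega>. (Z (W \<omega>) k, \<xi> j \<omega>)) = N \<Otimes>\<^sub>M P"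
    unfolding N_def by (rule Z_xi_law[OF kj])
  have g: "g \<in> borel_measurable (S \<Otimes>\<^sub>M P)" using F_meas by (simp add: g_def)
  have "integrable (distr \<Omega> (S \<Otimes>\<^sub>M P) (\<lambda>\<omega>. (Z (W \<omega>) k, \<xi> j \<omega>))) g"
    using F_integrable[OF kj] by (subst integrable_distr_eq[OF Z_xi_measurable[OF kj] g]) (simp add: g_def)
  then have gint: "integrable (N \<Otimes>\<^sub>M P) g" unfolding lawN .
  have inner: "(\<integral>v. g (x, v) \<partial>P) = fr x" if "x \<in> space N" for x
    using that f_mean[of x] by (simp add: g_def N_def space_restrict_space)
  have "integrable N (\<lambda>x. \<integral>v. g (x, v) \<partial>P)" by (rule NP.integrable_fst'[OF gint])
  then have frN: "integrable N fr" using inner by (simp cong: Bochner_Integration.integrable_cong)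
  then show "integrable \<Omega> (\<lambda>\<omega>. fr (Z (W \<omega>) k))" unfolding N_def by (rule integrable_distr[OF Zr])
  have "\<Omega>.expectation (\<lambda>\<omega>. F (Z (W \<omega>) k) (\<xi> j \<omega>)) = integral\<^sup>L (N \<Otimes>\<^sub>M P) g"
    unfolding lawN[symmetric] integral_distr[OF Z_xi_measurable[OF kj] g] by (simp add: g_def)
  also have "\<dots> = (\<integral>x. \<integral>v. g (x, v) \<partial>P \<partial>N)" by (rule NP.integral_fst'[OF gint, symmetric])
  also have "\<dots> = (\<integral>x. fr x \<partial>N)" using inner by (intro Bochner_Integration.integral_cong) auto
  also have "\<dots> = \<Omega>.expectation (\<lambda>\<omega>. fr (Z (W \<omega>) k))"
    unfolding N_def
  proof (rule integral_distr[OF Zr])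
    have "fr \<in> borel_measurable N" using frN by auto
    then show "fr \<in> borel_measurable S" by (simp add: N_def)
  qed
  finally show "\<Omega>.expectation (\<lambda>\<omega>. F (Z (W \<omega>) k) (\<xi> j \<omega>)) = \<Omega>.expectation (\<lambda>\<omega>. fr (Z (W \<omega>) k))" .
qed

end

section \<open>Expected bounds for the output\<close>

text \<open>
  The value \<open>(1 - \<beta>) c / \<beta>\<close> is a fixed point of the averaging step, and the deviation of the
  initial value from it, which is at most \<open>c\<close>, shrinks by a factor \<open>\<beta>\<close> per step.
\<close>

lemma damped_avg_geometric:
  assumes "0 < \<beta>" "\<beta> < 1" "0 \<le> c"
  shows "damped_max \<beta> {} (\<lambda>i. if i = 0 then c else (1 - \<beta>) * c / \<beta>) j \<le> c * (\<beta> ^ j + (1 - \<beta>) / \<beta>)"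
proof (induction j)
  case 0
  have "c * 1 \<le> c * (1 + (1 - \<beta>) / \<beta>)" using assms by (intro mult_left_mono) auto
  then show ?case by simp
next
  case (Suc j)
  let ?r = "(1 - \<beta>) / \<beta>"
  have "\<beta> * damped_max \<beta> {} (\<lambda>i. if i = 0 then c else (1 - \<beta>) * c / \<beta>) j \<le> \<beta> * (c * (\<beta> ^ j + ?r))"
    using Suc assms by (intro mult_left_mono) auto
  then have "damped_max \<beta> {} (\<lambda>i. if i = 0 then c else (1 - \<beta>) * c / \<beta>) (Suc j)
      \<le> (1 - \<beta>) * ((1 - \<beta>) * c / \<beta>) + \<beta> * (c * (\<beta> ^ j + ?r))" by simp
  also have "\<dots> = c * (\<beta> ^ Suc j + ?r)" using assms by (simp add: field_simps)
  finally show ?case .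
qed

context smax1c_random
begin

lemma step_cost_expectation:
  assumes j: "j < I"
  shows "integrable \<Omega> (\<lambda>\<omega>. step_cost (W \<omega>) j)"
    and "integrable \<Omega> (\<lambda>\<omega>. fr (Z (W \<omega>) (Suc j)) + hr (Z (W \<omega>) (Suc j)))"
    and "\<Omega>.expectation (\<lambda>\<omega>. step_cost (W \<omega>) j)
      = \<Omega>.expectation (\<lambda>\<omega>. fr (Z (W \<omega>) (Suc j)) + hr (Z (W \<omega>) (Suc j)))"
proof -
  have kj: "Suc j \<le> Suc j" "Suc j \<le> I" "Suc j \<le> Suc I" using j by auto
  note int = F_integrable[OF kj(1,2)] Z_square_integrable(2)[OF kj(3)] F_expectation(1)[OF kj(1,2)]
  show "integrable \<Omega> (\<lambda>\<omega>. step_cost (W \<omega>) j)"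
    "integrable \<Omega> (\<lambda>\<omega>. fr (Z (W \<omega>) (Suc j)) + hr (Z (W \<omega>) (Suc j)))"
    unfolding step_cost_def using int by (auto intro!: Bochner_Integration.integrable_add simp del: smax_z.simps)
  show "\<Omega>.expectation (\<lambda>\<omega>. step_cost (W \<omega>) j)
      = \<Omega>.expectation (\<lambda>\<omega>. fr (Z (W \<omega>) (Suc j)) + hr (Z (W \<omega>) (Suc j)))"
    unfolding step_cost_def using int F_expectation(2)[OF kj(1,2)]
    by (simp add: Bochner_Integration.integral_add del: smax_z.simps)
qed

lemma smax_u_expectation:
  "integrable \<Omega> (\<lambda>\<omega>. damped_max \<beta> {} (step_cost (W \<omega>)) (I - 1))"
  "eexpectation \<Omega> (\<lambda>\<omega>. smax_u F s h lam I B z0 (W \<omega>) I)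
    = ereal (\<Omega>.expectation (\<lambda>\<omega>. damped_max \<beta> {} (step_cost (W \<omega>)) (I - 1)))"
proof -
  show int: "integrable \<Omega> (\<lambda>\<omega>. damped_max \<beta> {} (step_cost (W \<omega>)) (I - 1))"
    using I by (intro damped_max_integrable step_cost_expectation) auto
  have "I = Suc (I - 1)" using I by simp
  then have "smax_u F s h lam I B z0 (W \<omega>) I = ereal (damped_max \<beta> {} (step_cost (W \<omega>)) (I - 1))" for \<omega>
    using smax_u_eq[of "W \<omega>" "I - 1"] by metis
  then show "eexpectation \<Omega> (\<lambda>\<omega>. smax_u F s h lam I B z0 (W \<omega>) I)
    = ereal (\<Omega>.expectation (\<lambda>\<omega>. damped_max \<beta> {} (step_cost (W \<omega>)) (I - 1)))"
    by (intro eexpectation_eq_integral[OF int]) simp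
qed

text \<open>
  Convexity bounds \<open>\<phi>(z\<^sub>I\<^sup>a)\<close> by the damped average of the \<open>\<phi>(z\<^sub>j)\<close>, and the entries of the two
  damped averages have equal means because each \<open>z\<^sub>j\<close> is evaluated with a fresh sample.
\<close>

lemma phi_average_le_smax_u:
  assumes f: "proper_closed_convex f" and dom: "edom h \<subseteq> edom f"
  shows "eexpectation \<Omega> (\<lambda>\<omega>. phi f h (smax_za F s h lam I B z0 (W \<omega>) I))
    \<le> eexpectation \<Omega> (\<lambda>\<omega>. smax_u F s h lam I B z0 (W \<omega>) I)"
proof -
  let ?p = "\<lambda>\<omega> i. fr (Z (W \<omega>) (Suc i)) + hr (Z (W \<omega>) (Suc i))"
  have I': "Suc (I - 1) = I" using I by simp
  have int: "integrable \<Omega> (\<lambda>\<omega>. ?p \<omega> i)" "integrable \<Omega> (\<lambda>\<omega>. step_cost (W \<omega>) i)"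
    "\<Omega>.expectation (\<lambda>\<omega>. step_cost (W \<omega>) i) = \<Omega>.expectation (\<lambda>\<omega>. ?p \<omega> i)" if "i \<le> I - 1" for i
    using step_cost_expectation[of i] that I by auto
  have "eexpectation \<Omega> (\<lambda>\<omega>. phi f h (smax_za F s h lam I B z0 (W \<omega>) I))
      \<le> eexpectation \<Omega> (\<lambda>\<omega>. ereal (damped_max \<beta> {} (?p \<omega>) (I - 1)))"
    using phi_average_le[OF f dom, of "W _" "I - 1"] unfolding I' by (rule eexpectation_mono)
  also have "\<dots> = ereal (\<Omega>.expectation (\<lambda>\<omega>. damped_max \<beta> {} (?p \<omega>) (I - 1)))"
    by (intro eexpectation_eq_integral damped_max_integrable int) auto
  also have "\<Omega>.expectation (\<lambda>\<omega>. damped_max \<beta> {} (?p \<omega>) (I - 1))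
      = damped_max \<beta> {} (\<lambda>i. \<Omega>.expectation (\<lambda>\<omega>. ?p \<omega> i)) (I - 1)"
    by (rule integral_damped_avg[OF int(1)])
  also have "\<dots> = damped_max \<beta> {} (\<lambda>i. \<Omega>.expectation (\<lambda>\<omega>. step_cost (W \<omega>) i)) (I - 1)"
    by (intro damped_max_cong int(3)[symmetric])
  also have "\<dots> = \<Omega>.expectation (\<lambda>\<omega>. damped_max \<beta> {} (step_cost (W \<omega>)) (I - 1))"
    by (rule integral_damped_avg[OF int(2), symmetric])
  finally show ?thesis unfolding smax_u_expectation(2) .
qed

lemma step_error_expectation:
  assumes j: "j < I"
  shows "integrable \<Omega> (\<lambda>\<omega>. step_error (W \<omega>) j)"
    and "\<Omega>.expectation (\<lambda>\<omega>. step_error (W \<omega>) j)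
      \<le> (if j = 0 then 2 * lam * M\<^sup>2 else (1 - \<beta>) * (2 * lam * M\<^sup>2) / \<beta>)"
proof -
  define c where "c = (if j = 0 then lam else (1 - \<beta>) * lam / \<beta>)"
  have c: "0 \<le> c" using lam beta by (simp add: c_def)
  have j': "j \<le> Suc j" "Suc j \<le> I" "j \<le> j" "j \<le> I" "Suc j \<le> Suc j" using j by auto
  note F = F_integrable[OF j'(1,2)] F_integrable[OF j'(3,4)]
  note s = s_square_integrable[OF j'(3,4)] s_square_integrable[OF j'(5,2)]
  have eq: "step_error (W \<omega>) j = F (Z (W \<omega>) j) (\<xi> (Suc j) \<omega>) - F (Z (W \<omega>) j) (\<xi> j \<omega>)
      + c * ((norm (sg (W \<omega>) j))\<^sup>2 + (norm (sg (W \<omega>) (Suc j)))\<^sup>2)" for \<omega>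
    by (simp add: step_error_def c_def del: smax_z.simps)
  show "integrable \<Omega> (\<lambda>\<omega>. step_error (W \<omega>) j)"
    unfolding eq using F s
    by (intro Bochner_Integration.integrable_add Bochner_Integration.integrable_diff integrable_mult_right)
  have "\<Omega>.expectation (\<lambda>\<omega>. step_error (W \<omega>) j) = c * (\<Omega>.expectation (\<lambda>\<omega>. (norm (sg (W \<omega>) j))\<^sup>2)
      + \<Omega>.expectation (\<lambda>\<omega>. (norm (sg (W \<omega>) (Suc j)))\<^sup>2))"
    unfolding eq using F s F_expectation(2)[OF j'(1,2)] F_expectation(2)[OF j'(3,4)]
    by (simp add: Bochner_Integration.integral_add Bochner_Integration.integral_diff del: smax_z.simps)
  also have "\<dots> \<le> c * (M\<^sup>2 + M\<^sup>2)" using s c by (intro mult_left_mono add_mono)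
  finally show "\<Omega>.expectation (\<lambda>\<omega>. step_error (W \<omega>) j)
      \<le> (if j = 0 then 2 * lam * M\<^sup>2 else (1 - \<beta>) * (2 * lam * M\<^sup>2) / \<beta>)"
    by (cases "j = 0") (simp_all add: c_def algebra_simps del: smax_z.simps)
qed

lemma damped_step_error_expectation:
  assumes j: "j < I"
  shows "integrable \<Omega> (\<lambda>\<omega>. damped_max \<beta> {} (step_error (W \<omega>)) j)"
    and "\<Omega>.expectation (\<lambda>\<omega>. damped_max \<beta> {} (step_error (W \<omega>)) j)
      \<le> 2 * lam * M\<^sup>2 * (\<beta> ^ j + (1 - \<beta>) / \<beta>)"
proof -
  have int: "integrable \<Omega> (\<lambda>\<omega>. step_error (W \<omega>) i)" if "i \<le> j" for i
    using that j by (intro step_error_expectation) auto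
  show "integrable \<Omega> (\<lambda>\<omega>. damped_max \<beta> {} (step_error (W \<omega>)) j)"
    by (intro damped_max_integrable int)
  have "\<Omega>.expectation (\<lambda>\<omega>. damped_max \<beta> {} (step_error (W \<omega>)) j)
      = damped_max \<beta> {} (\<lambda>i. \<Omega>.expectation (\<lambda>\<omega>. step_error (W \<omega>) i)) j"
    by (rule integral_damped_avg[OF int])
  also have "\<dots> \<le> damped_max \<beta> {} (\<lambda>i. if i = 0 then 2 * lam * M\<^sup>2 else (1 - \<beta>) * (2 * lam * M\<^sup>2) / \<beta>) j"
    using j beta by (intro damped_max_mono step_error_expectation(2)) auto
  also have "\<dots> \<le> 2 * lam * M\<^sup>2 * (\<beta> ^ j + (1 - \<beta>) / \<beta>)"
    using beta lam by (intro damped_avg_geometric) auto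
  finally show "\<Omega>.expectation (\<lambda>\<omega>. damped_max \<beta> {} (step_error (W \<omega>)) j)
      \<le> 2 * lam * M\<^sup>2 * (\<beta> ^ j + (1 - \<beta>) / \<beta>)" .
qed

lemma output_gap_expectation:
  assumes x: "x \<in> edom h"
  shows "\<Omega>.expectation (\<lambda>\<omega>. damped_max \<beta> {} (step_cost (W \<omega>)) (I - 1))
    \<le> fr x + hr x + \<Omega>.expectation (\<lambda>\<omega>. damped_max \<beta> B (\<lambda>i. F x (\<xi> i \<omega>) - fr x) (I - 1))
      + 1 / (2 * lam) * (norm (x - z0))\<^sup>2 + 2 * lam * M\<^sup>2 * (\<beta> ^ (I - 1) + (1 - \<beta>) / \<beta>)"
proof -
  let ?Y = "\<lambda>\<omega>. damped_max \<beta> B (\<lambda>i. F x (\<xi> i \<omega>) - fr x) (I - 1)"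
  let ?E = "\<lambda>\<omega>. damped_max \<beta> {} (step_error (W \<omega>)) (I - 1)"
  define c where "c = fr x + hr x + 1 / (2 * lam) * (norm (x - z0))\<^sup>2"
  have j: "I - 1 < I" "Suc (I - 1) \<le> I" using I by auto
  have Y: "integrable \<Omega> ?Y"
    by (intro damped_max_integrable Bochner_Integration.integrable_diff F_at_sample x) auto
  note E = damped_step_error_expectation[OF j(1)]
  have shift: "damped_max \<beta> B (\<lambda>i. F x (\<xi> i \<omega>)) (I - 1) = ?Y \<omega> + fr x" for \<omega>
    using damped_max_translate[of \<beta> B "\<lambda>i. F x (\<xi> i \<omega>) - fr x" "fr x" "I - 1"] by simp
  have "AE \<omega> in \<Omega>. damped_max \<beta> {} (step_cost (W \<omega>)) (I - 1) \<le> c + ?Y \<omega> + ?E \<omega>"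
    using AE_samples_ok
  proof eventually_elim
    case (elim \<omega>)
    show ?case using output_gap_le[OF elim x j(2)] shift[of \<omega>] unfolding c_def by linarith
  qed
  then have "\<Omega>.expectation (\<lambda>\<omega>. damped_max \<beta> {} (step_cost (W \<omega>)) (I - 1))
      \<le> \<Omega>.expectation (\<lambda>\<omega>. c + ?Y \<omega> + ?E \<omega>)"
    using Y E(1) by (intro integral_mono_AE smax_u_expectation(1) Bochner_Integration.integrable_add) auto
  also have "\<dots> = c + \<Omega>.expectation ?Y + \<Omega>.expectation ?E"
    using Y E(1) by (simp add: \<Omega>.prob_space)
  finally show ?thesis using E(2) unfolding c_def by linarith
qed

lemma noise_centred:
  assumes x: "x \<in> edom h" and j: "j \<le> I"
  shows "integrable \<Omega> (\<lambda>\<omega>. F x (\<xi> j \<omega>) - fr x)"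
    and "\<Omega>.expectation (\<lambda>\<omega>. F x (\<xi> j \<omega>) - fr x) = 0"
  using F_at_sample[OF x j] by (simp_all add: \<Omega>.prob_space)

text \<open>
  Without maxima the aggregation is linear and preserves mean zero, even if the variance is
  infinite. The case is separate because the final bound then contains no noise term.
\<close>

lemma noise_singleton:
  assumes x: "x \<in> edom h" and B: "B = {1}"
  shows "\<Omega>.expectation (\<lambda>\<omega>. damped_max \<beta> B (\<lambda>i. F x (\<xi> i \<omega>) - fr x) (I - 1)) = 0"
proof -
  have "\<Omega>.expectation (\<lambda>\<omega>. damped_max \<beta> B (\<lambda>i. F x (\<xi> i \<omega>) - fr x) (0 + (I - 1)))
      = \<beta> ^ (I - 1) * \<Omega>.expectation (\<lambda>\<omega>. damped_max \<beta> B (\<lambda>i. F x (\<xi> i \<omega>) - fr x) 0)"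
    by (rule \<Omega>.damped_max_centred_tail[where n = "I - 1"]) (auto simp: B intro!: noise_centred x)
  then show ?thesis using noise_centred(2)[OF x, of 0] by simp
qed

lemma noise_bound:
  assumes x: "x \<in> edom h" and int2: "integrable P (\<lambda>v. (F x v - fr x)\<^sup>2)"
    and B: "1 \<in> B" "B \<subseteq> {1..I div 2}"
  shows "\<Omega>.expectation (\<lambda>\<omega>. damped_max \<beta> B (\<lambda>i. F x (\<xi> i \<omega>) - fr x) (I - 1))
    \<le> \<beta> ^ (I - I div 2) * sqrt (real (card B) * (\<integral>v. (F x v - fr x)\<^sup>2 \<partial>P))"
proof -
  let ?v = "\<integral>v. (F x v - fr x)\<^sup>2 \<partial>P"
  have sq: "integrable \<Omega> (\<lambda>\<omega>. (F x (\<xi> i \<omega>) - fr x)\<^sup>2)"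
    "\<Omega>.expectation (\<lambda>\<omega>. (F x (\<xi> i \<omega>) - fr x)\<^sup>2) = ?v" if i: "i \<le> I" for i
  proof -
    show "integrable \<Omega> (\<lambda>\<omega>. (F x (\<xi> i \<omega>) - fr x)\<^sup>2)"
      by (rule integrable_distr[OF xi_measurable[OF i], where f = "\<lambda>v. (F x v - fr x)\<^sup>2"]) (simp only: law[OF i] int2)
    have "(\<integral>v. (F x v - fr x)\<^sup>2 \<partial>distr \<Omega> P (\<xi> i)) = \<Omega>.expectation (\<lambda>\<omega>. (F x (\<xi> i \<omega>) - fr x)\<^sup>2)"
      using int2 by (intro integral_distr xi_measurable i) auto
    then show "\<Omega>.expectation (\<lambda>\<omega>. (F x (\<xi> i \<omega>) - fr x)\<^sup>2) = ?v" by (simp only: law[OF i])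
  qed
  have k: "I - 1 - (I div 2 - 1) = I - I div 2" "Suc (I div 2 - 1) = I div 2" using I by auto
  have "\<Omega>.expectation (\<lambda>\<omega>. damped_max \<beta> B (\<lambda>i. F x (\<xi> i \<omega>) - fr x) (I - 1))
    \<le> \<beta> ^ (I - 1 - (I div 2 - 1)) * sqrt (real (card B) * ?v)"
    \<comment> \<open>iteration \<open>I div 2\<close>, the last that can be in \<open>B\<close>, has index \<open>I div 2 - 1\<close> in the aggregate\<close>
    using B sq beta
    by (intro \<Omega>.damped_max_centred_bound noise_centred x) (auto simp: k(2) intro!: integral_nonneg_AE)
  then show ?thesis unfolding k .
qed

end

section \<open>Constants\<close>

lemma one_le_ln_Suc:
  assumes "I \<ge> 2"
  shows "1 \<le> ln (real I + 1)"
proof -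
  have "exp 1 \<le> real I + 1" using exp_le assms by linarith
  then show ?thesis by (subst ln_ge_iff) auto
qed

text \<open>
  With \<open>L = ln (I + 1)\<close> and \<open>N = I + 1\<close>, \<open>\<beta> = 1 - 2 L / (N + L) \<le> exp (- 2 L / (N + L))\<close>, and
  \<open>L \<le> N / 2\<close> gives the rate \<open>4 L / (3 N)\<close> per step.
\<close>

lemma smax_beta_power_le:
  assumes I: "I \<ge> 2" and t: "t * (real I + 1) \<le> 4 / 3 * real m"
  shows "smax_beta I ^ m \<le> exp (- t * ln (real I + 1))"
proof -
  define L N where "L = ln (real I + 1)" and "N = real I + 1"
  have L: "0 < L" using I by (simp add: L_def)
  have LN: "L \<le> N / 2" "0 < N" unfolding L_def N_def by (rule ln_le_half) simp_all
  have "smax_beta I = (N - L) / (N + L)" by (simp add: smax_beta_def L_def N_def)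
  also have "\<dots> = 1 + - (2 * L / (N + L))" using L LN by (simp add: field_simps)
  also have "\<dots> \<le> exp (- (2 * L / (N + L)))" by (rule exp_ge_add_one_self)
  also have "\<dots> \<le> exp (- (4 / 3 * L / N))" using L LN by (simp add: field_simps)
  finally have "smax_beta I ^ m \<le> exp (- (4 / 3 * L / N)) ^ m"
    using smax_beta_bounds[of I] I by (intro power_mono) auto
  also have "\<dots> = exp (- (4 / 3 * real m / N) * L)" by (simp add: exp_of_nat_mult[symmetric] field_simps)
  also have "\<dots> \<le> exp (- t * L)"
  proof -
    have "t \<le> 4 / 3 * real m / N" using t LN by (simp add: N_def field_simps)
    then have "t * L \<le> 4 / 3 * real m / N * L" using L by (intro mult_right_mono) auto
    then show ?thesis by simp
  qed
  finally show ?thesis by (simp add: L_def)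
qed

text \<open>
  The ratio \<open>(1 - \<beta>) / \<beta> = 2 L / (N - L)\<close> uses up \<open>4 L / N\<close>. The other \<open>18 L / N\<close> covers the
  initial error: trivially while \<open>N \<le> 18\<close>, and through \<open>\<beta>\<^sup>I\<^sup>-\<^sup>1 \<le> 1 / N\<close> afterwards.
\<close>

lemma smax_beta_error_constant:
  assumes I: "I \<ge> 2"
  shows "smax_beta I ^ (I - 1) + (1 - smax_beta I) / smax_beta I \<le> 22 * ln (real I + 1) / (real I + 1)"
proof -
  define L N where "L = ln (real I + 1)" and "N = real I + 1"
  have L: "1 \<le> L" using one_le_ln_Suc[OF I] by (simp add: L_def)
  have LN: "L \<le> N / 2" "0 < N" unfolding L_def N_def by (rule ln_le_half) simp_all
  have \<beta>: "smax_beta I = (N - L) / (N + L)" by (simp add: smax_beta_def L_def N_def)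
  have "1 - smax_beta I = 2 * L / (N + L)" unfolding \<beta> using L LN by (simp add: field_simps)
  then have "(1 - smax_beta I) / smax_beta I = 2 * L / (N - L)" unfolding \<beta> using L LN by simp
  also have "\<dots> \<le> 2 * L / (N / 2)" using L LN by (intro divide_left_mono) auto
  finally have 1: "(1 - smax_beta I) / smax_beta I \<le> 4 * L / N" by simp
  have 2: "smax_beta I ^ (I - 1) \<le> 18 * L / N"
  proof (cases "I \<le> 17")
    case True
    have "smax_beta I ^ (I - 1) \<le> 1" using smax_beta_bounds[of I] I by (intro power_le_one) auto
    also have "1 \<le> 18 * L / N" using True L LN by (simp add: N_def field_simps)
    finally show ?thesis .
  next
    case False
    then have "smax_beta I ^ (I - 1) \<le> exp (- 1 * ln (real I + 1))"
      by (intro smax_beta_power_le I) (simp add: of_nat_diff)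
    also have "\<dots> = 1 / N" by (simp add: exp_minus N_def field_simps)
    also have "\<dots> \<le> 18 * L / N" using L LN by (intro divide_right_mono) auto
    finally show ?thesis .
  qed
  have "4 * L / N + 18 * L / N = 22 * L / N" by (simp add: add_divide_distrib[symmetric])
  then show ?thesis using 1 2 unfolding L_def N_def by linarith
qed

lemma smax_beta_half_power:
  assumes I: "I \<ge> 4"
  shows "smax_beta I ^ (I - I div 2) \<le> 1 / sqrt (real I + 1)"
proof -
  have "I \<le> 2 * (I - I div 2)" by linarith
  then have "real I \<le> real (2 * (I - I div 2))" by (simp only: of_nat_le_iff)
  then have "real I \<le> 2 * real (I - I div 2)" by (simp only: of_nat_mult of_nat_numeral)
  moreover have "4 \<le> real I" using I by simp
  ultimately have "1 / 2 * (real I + 1) \<le> 4 / 3 * real (I - I div 2)"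
    by (simp add: field_simps del: of_nat_diff)
  then have "smax_beta I ^ (I - I div 2) \<le> exp (- (1 / 2) * ln (real I + 1))"
    using I by (intro smax_beta_power_le) auto
  also have "\<dots> = 1 / exp (ln (real I + 1) / 2)" by (simp add: exp_minus field_simps)
  also have "exp (ln (real I + 1) / 2) = sqrt (real I + 1)"
  proof -
    have "ln (real I + 1) / 2 = ln (sqrt (real I + 1))" using ln_sqrt[of "real I + 1"] by simp
    then show ?thesis by (simp only: exp_ln) simp
  qed
  finally show ?thesis .
qed

lemma subgrad_bound_second_moment:
  fixes s :: "'a::euclidean_space \<Rightarrow> 'b \<Rightarrow> 'a"
  assumes s_meas: "(\<lambda>(x, v). s x v) \<in> borel_measurable (restrict_space borel (edom h) \<Otimes>\<^sub>M P)"
    and M: "subgrad_bound P s h = ereal M" and x: "x \<in> edom h"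
  shows "(\<integral>\<^sup>+v. ennreal ((norm (s x v))\<^sup>2) \<partial>P) \<le> ennreal (M\<^sup>2)"
proof -
  let ?e = "esqrt (eexpectation P (\<lambda>v. ereal ((norm (s x v))\<^sup>2)))"
  have "x \<in> space (restrict_space borel (edom h))" using x by (simp add: space_restrict_space)
  from measurable_compose[OF measurable_Pair1'[OF this] s_meas]
  have [measurable]: "s x \<in> borel_measurable P" by simp
  have le: "?e \<le> ereal M" unfolding M[symmetric] subgrad_bound_def using x by (rule SUP_upper)
  then have fin: "?e \<noteq> \<infinity>" by auto
  have m: "(\<lambda>v. norm (s x v)) \<in> borel_measurable P" by measurable
  note E = esqrt_eexpectation_square_finite[OF fin m]
  have "sqrt (\<integral>v. (norm (s x v))\<^sup>2 \<partial>P) \<le> M" using le unfolding E(2) by simp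
  then have "(\<integral>v. (norm (s x v))\<^sup>2 \<partial>P) \<le> M\<^sup>2" by (rule sqrt_le_D)
  moreover have "(\<integral>\<^sup>+v. ennreal ((norm (s x v))\<^sup>2) \<partial>P) = ennreal (\<integral>v. (norm (s x v))\<^sup>2 \<partial>P)"
    by (rule nn_integral_eq_integral[OF E(1)]) simp
  ultimately show ?thesis by (simp add: ennreal_leI)
qed

text \<open>
  The stepsize balances the two summands: with \<open>q = \<surd>(22 L)\<close> and \<open>n = \<surd>N\<close> each equals
  \<open>D M q / n\<close>.
\<close>

lemma smax_stepsize_balance:
  fixes D M L N lam :: real
  assumes D: "D > 0" and M: "M > 0" and L: "L > 0" and N: "N > 0"
    and lam: "lam = D * sqrt N / (2 * M * sqrt (22 * L))"
  shows "1 / (2 * lam) * D\<^sup>2 + 2 * lam * M\<^sup>2 * (22 * L / N) = 2 * sqrt L / sqrt N * (sqrt 22 * M * D)"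
proof -
  define q n where "q = sqrt (22 * L)" and "n = sqrt N"
  have q: "q > 0" "22 * L = q * q" and n: "n > 0" "N = n * n" using L N by (auto simp: q_def n_def)
  have lam': "lam = D * n / (2 * M * q)" by (simp add: lam q_def n_def)
  have "1 / (2 * lam) * D\<^sup>2 = D * M * q / n"
    using q n D M by (simp add: lam' power2_eq_square)
  moreover have "2 * lam * M\<^sup>2 * (22 * L / N) = D * M * q / n"
    unfolding q(2) n(2) using q(1) n(1) D M by (simp add: lam' power2_eq_square)
  moreover have "2 * sqrt L / sqrt N * (sqrt 22 * M * D) = 2 * (D * M * q / n)"
    by (simp add: q_def n_def real_sqrt_mult)
  ultimately show ?thesis by simp
qed

theorem theorem3p1:
  fixes f h :: "real ^ 'n \<Rightarrow> ereal"
    and P :: "'b measure"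
    and F :: "real ^ 'n \<Rightarrow> 'b \<Rightarrow> real"
    and s :: "real ^ 'n \<Rightarrow> 'b \<Rightarrow> real ^ 'n"
    and \<Omega> :: "'w measure"
    and \<xi> :: "nat \<Rightarrow> 'w \<Rightarrow> 'b"
    and M D lam :: real
    and I :: nat
    and B :: "nat set"
    and z0 xstar :: "real ^ 'n"
  assumes f: "proper_closed_convex f"
    and h: "proper_closed_convex h"
    and dom: "edom h \<subseteq> edom f"
    and P: "prob_space P"
    and F_meas: "(\<lambda>(x, v). F x v) \<in> borel_measurable (restrict_space borel (edom h) \<Otimes>\<^sub>M P)"
    and s_meas: "(\<lambda>(x, v). s x v) \<in> borel_measurable (restrict_space borel (edom h) \<Otimes>\<^sub>M P)"
    and F_convex: "AE v in P. convex_on (edom h) (\<lambda>x. F x v)"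
    and f_mean: "\<And>x. x \<in> edom h \<Longrightarrow> integrable P (F x) \<and> f x = ereal (\<integral>v. F x v \<partial>P)"
    and s_subgrad: "AE v in P. \<forall>x\<in>edom h. s x v \<in> subdifferential (edom h) (\<lambda>x. F x v) x"
    and M: "subgrad_bound P s h = ereal M" "M > 0"
    and solvable: "minimizers (phi f h) \<noteq> {}"
    and z0: "z0 \<in> edom h"
    and xstar: "xstar = closest_point (minimizers (phi f h)) z0"
    and D: "D \<ge> norm (z0 - xstar)" "D > 0"
    and I: "I \<ge> 2"
    and B: "{1} \<subseteq> B" "B \<subseteq> {1..I div 2}"
    and lam: "lam = D * sqrt (real I + 1) / (2 * M * sqrt (22 * ln (real I + 1)))"
    and \<Omega>: "prob_space \<Omega>"
    and \<xi>_indep: "prob_space.indep_vars \<Omega> (\<lambda>_. P) \<xi> {0..I}"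
    and \<xi>_law: "\<And>j. j \<le> I \<Longrightarrow> distr \<Omega> P (\<xi> j) = P"
  shows "eexpectation \<Omega> (\<lambda>\<omega>. phi f h (smax_za F s h lam I B z0 (\<lambda>j. \<xi> j \<omega>) I))
             - (INF x. phi f h x)
           \<le> eexpectation \<Omega> (\<lambda>\<omega>. smax_u F s h lam I B z0 (\<lambda>j. \<xi> j \<omega>) I)
             - (INF x. phi f h x)
       \<and> eexpectation \<Omega> (\<lambda>\<omega>. smax_u F s h lam I B z0 (\<lambda>j. \<xi> j \<omega>) I)
             - (INF x. phi f h x)
           \<le> ereal (2 * sqrt (ln (real I + 1)) / sqrt (real I + 1))
             * (ereal (sqrt 22 * M * D)
                + 2 * noise_std P F f h xstar * ereal (sqrt (real (card B) - 1)))"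
proof -
  define L N where "L = ln (real I + 1)" and "N = real I + 1"
  have L: "1 \<le> L" using one_le_ln_Suc[OF I] by (simp add: L_def)
  have N: "0 < N" by (simp add: N_def)
  have stepsize: "lam = D * sqrt N / (2 * M * sqrt (22 * L))" by (simp add: lam L_def N_def)
  then have lam_pos: "lam > 0"
    using D(2) M(2) L N by simp
  interpret smax1c_random F s h lam I B z0 P \<Omega> f \<xi> M
    by (intro smax1c_random.intro smax1c.intro smax1c_random_axioms.intro)
      (use assms lam_pos subgrad_bound_second_moment[OF s_meas M(1)] in auto)
  have xmin: "xstar \<in> minimizers (phi f h)"
    unfolding xstar by (rule closest_minimizer_in_minimizers[OF f h dom solvable])
  have "phi f h xstar \<le> phi f h z0" using xmin by (simp add: minimizers_def)
  also have "\<dots> < \<infinity>" using z0 dom by (auto simp: phi_def edom_def)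
  finally have "f xstar + h xstar < \<infinity>" by (simp add: phi_def)
  then have x: "xstar \<in> edom h"
    using proper_closed_convex_not_MInf[OF f, of xstar] by (auto simp: edom_def)
  obtain p where p: "f xstar = ereal p" using f_mean[OF x] by blast
  obtain r where r: "h xstar = ereal r" by (rule that[OF ereal_real_on_edom[OF h x, symmetric]])
  have inf: "(INF x. phi f h x) = ereal (p + r)"
  proof -
    have "(INF x. phi f h x) = phi f h xstar"
      using xmin by (intro antisym INF_lower INF_greatest) (auto simp: minimizers_def)
    then show ?thesis by (simp add: phi_def p r)
  qed
  define U where "U = \<Omega>.expectation (\<lambda>\<omega>. damped_max \<beta> {} (step_cost (W \<omega>)) (I - 1))"
  have U: "eexpectation \<Omega> (\<lambda>\<omega>. smax_u F s h lam I B z0 (W \<omega>) I) = ereal U"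
    unfolding U_def by (rule smax_u_expectation(2))
  define E where "E = \<Omega>.expectation (\<lambda>\<omega>. damped_max \<beta> B (\<lambda>i. F xstar (\<xi> i \<omega>) - p) (I - 1))"
  define K where "K = 2 * sqrt L / sqrt N"
  define G where "G = sqrt 22 * M * D"
  have K: "0 < K" using L N by (simp add: K_def)
  have UE: "U - (p + r) \<le> E + K * G"
  proof -
    have "1 / (2 * lam) * (norm (xstar - z0))\<^sup>2 \<le> 1 / (2 * lam) * D\<^sup>2"
      using D lam_pos by (intro mult_left_mono power_mono) (auto simp: norm_minus_commute)
    moreover have "2 * lam * M\<^sup>2 * (\<beta> ^ (I - 1) + (1 - \<beta>) / \<beta>) \<le> 2 * lam * M\<^sup>2 * (22 * L / N)"
      using lam_pos smax_beta_error_constant[OF I] by (intro mult_left_mono) (auto simp: L_def N_def)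
    moreover have "1 / (2 * lam) * D\<^sup>2 + 2 * lam * M\<^sup>2 * (22 * L / N) = K * G"
      unfolding K_def G_def using L N D M stepsize by (intro smax_stepsize_balance) auto
    ultimately show ?thesis
      using output_gap_expectation[OF x] unfolding U_def[symmetric] p r real_of_ereal.simps E_def[symmetric]
      by linarith
  qed
  have finB: "finite B" using B(2) finite_subset by blast
  have cB: "1 \<le> card B" using B(1) finB by (metis card_mono card.empty card_insert_disjoint empty_iff finite.emptyI One_nat_def)
  have second: "ereal U - ereal (p + r) \<le> ereal K * (ereal G + 2 * noise_std P F f h xstar * ereal (sqrt (real (card B) - 1)))"
  proof (cases "card B = 1")
    case True
    then have "B = {1}" using B(1) by (metis card_1_singletonE insert_subset singletonD)
    then have "E = 0" using noise_singleton[OF x] unfolding E_def p by simp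
    then show ?thesis using UE True by (simp flip: zero_ereal_def)
  next
    case False
    then have c2: "2 \<le> card B" using cB by simp
    have noise: "noise_std P F f h xstar = esqrt (eexpectation P (\<lambda>v. ereal ((F xstar v - p)\<^sup>2)))"
      unfolding noise_std_def Phi_def phi_def p r by (simp add: power2_eq_square)
    show ?thesis
    proof (cases "noise_std P F f h xstar = \<infinity>")
      case True
      \<comment> \<open>\<open>|B| \<ge> 2\<close> gives the infinite deviation a positive factor\<close>
      have "ereal K * (ereal G + 2 * noise_std P F f h xstar * ereal (sqrt (real (card B) - 1))) = \<infinity>"
        unfolding True using K c2 by simp
      then show ?thesis by (simp only: ereal_less_eq)
    next
      case fin: False
      have Fm: "(\<lambda>v. F xstar v - p) \<in> borel_measurable P" using f_mean[OF x] by auto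
      note S = esqrt_eexpectation_square_finite[OF fin[unfolded noise] Fm]
      define \<sigma> where "\<sigma> = sqrt (\<integral>v. (F xstar v - p)\<^sup>2 \<partial>P)"
      have \<sigma>: "0 \<le> \<sigma>" by (simp add: \<sigma>_def)
      have \<sigma>n: "noise_std P F f h xstar = ereal \<sigma>" unfolding noise \<sigma>_def by (rule S(2))
      have "card B \<le> I div 2" using card_mono[OF _ B(2)] by simp
      then have I4: "I \<ge> 4" using c2 by linarith
      have "E \<le> \<beta> ^ (I - I div 2) * sqrt (real (card B) * (\<integral>v. (F xstar v - p)\<^sup>2 \<partial>P))"
        using noise_bound[OF x] S(1) B unfolding E_def p by simp
      also have "\<dots> = \<beta> ^ (I - I div 2) * (sqrt (real (card B)) * \<sigma>)"
        by (simp add: \<sigma>_def real_sqrt_mult)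
      also have "\<dots> \<le> 1 / sqrt N * (sqrt (real (card B)) * \<sigma>)"
        using smax_beta_half_power[OF I4] \<sigma> by (intro mult_right_mono) (auto simp: N_def)
      also have "\<dots> \<le> 1 / sqrt N * ((4 * sqrt L * sqrt (real (card B) - 1)) * \<sigma>)"
      proof -
        \<comment> \<open>\<open>|B| \<le> 2 (|B| - 1)\<close> would do; \<open>16\<close> is the square of the constant in the bound\<close>
        have "real (card B) \<le> 16 * (1 * (real (card B) - 1))" using c2 by simp
        also have "\<dots> \<le> 16 * (L * (real (card B) - 1))" using L c2 by (intro mult_left_mono mult_right_mono) auto
        finally have "sqrt (real (card B)) \<le> sqrt (16 * (L * (real (card B) - 1)))" by (rule real_sqrt_le_mono)
        also have "\<dots> = 4 * sqrt L * sqrt (real (card B) - 1)" by (simp add: real_sqrt_mult)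
        finally show ?thesis using \<sigma> N by (intro mult_left_mono mult_right_mono) auto
      qed
      also have "\<dots> = K * (2 * \<sigma> * sqrt (real (card B) - 1))" by (simp add: K_def)
      finally have "U - (p + r) \<le> K * (G + 2 * \<sigma> * sqrt (real (card B) - 1))"
        using UE by (simp add: distrib_left)
      then show ?thesis
        unfolding \<sigma>n by (simp only: numeral_eq_ereal times_ereal.simps plus_ereal.simps ereal_minus ereal_less_eq)
    qed
  qed
  have first: "eexpectation \<Omega> (\<lambda>\<omega>. phi f h (smax_za F s h lam I B z0 (W \<omega>) I)) - ereal (p + r)
      \<le> eexpectation \<Omega> (\<lambda>\<omega>. smax_u F s h lam I B z0 (W \<omega>) I) - ereal (p + r)"
    by (intro ereal_minus_mono phi_average_le_smax_u f dom) simp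
  show ?thesis
    unfolding inf using first second unfolding U K_def G_def L_def N_def by blast
qed

end
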